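(* Let $k$ be a field, let $\mathcal{D}$ be a $k$-category and let $E=\{E_i\}_{i\in I}$ be a partition of the set of objects of $\mathcal{D}$ by means of finite sets. Then $\mathcal{D}$ and the contracted category $\mathcal{D}_E$ are Morita equivalent.
   Context: A $k$-category is a category whose objects form a set $\mathcal{D}_0$, whose morphism sets ${}_y\mathcal{D}_x$ (from $x$ to $y$) are $k$-vector spaces, and whose composition is $k$-bilinear. Functors and equivalences between $k$-linear categories are understood to be $k$-linear. A left $\mathcal{D}$-module is a $k$-linear covariant functor from $\mathcal{D}$ to $k$-vector spaces, with natural transformations as morphisms; two $k$-categories are Morita equivalent if their categories of left modules are equivalent. The contracted category $\mathcal{D}_E$ has set of objects $I$ and morphisms ${}_j(\mathcal{D}_E)_i=\bigoplus_{y\in E_j,\,x\in E_i}{}_y\mathcal{D}_x$; composition is the matrix product combined with the composition of $\mathcal{D}$, and the identity of $i$ is $\sum_{z\in E_i}1_z$. *)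

theory Defs
  imports "HOL-Library.Disjoint_Sets" "HOL-Library.Infinite_Typeclass" "HOL-Algebra.Module"
begin

section \<open>Linear maps and pointwise vector spaces\<close>

text \<open>A vector space over a field \<open>k\<close> is a \<open>module\<close> of HOL-Algebra over \<open>k\<close>; the fields \<open>mult\<close> and
  \<open>one\<close> that the record \<open>module\<close> inherits from \<open>ring\<close> play no role.\<close>

definition linear_map ::
  "('k, 'r) ring_scheme \<Rightarrow> ('k, 'm) module \<Rightarrow> ('k, 'n) module \<Rightarrow> ('m \<Rightarrow> 'n) \<Rightarrow> bool" where
  "linear_map k V W f \<longleftrightarrow>
     f \<in> carrier V \<rightarrow> carrier W \<and>
     (\<forall>u\<in>carrier V. \<forall>v\<in>carrier V. f (u \<oplus>\<^bsub>V\<^esub> v) = f u \<oplus>\<^bsub>W\<^esub> f v) \<and>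
     (\<forall>a\<in>carrier k. \<forall>v\<in>carrier V. f (a \<odot>\<^bsub>V\<^esub> v) = a \<odot>\<^bsub>W\<^esub> f v)"

definition pointwise_module ::
  "'i set \<Rightarrow> ('i \<Rightarrow> ('k, 'm) module) \<Rightarrow> ('i \<Rightarrow> 'm) set \<Rightarrow> ('k, 'i \<Rightarrow> 'm) module" where
  "pointwise_module I V S =
     \<lparr>carrier = S, monoid.mult = undefined, one = undefined,
      zero = (\<lambda>i\<in>I. \<zero>\<^bsub>V i\<^esub>),
      add = (\<lambda>f g. \<lambda>i\<in>I. f i \<oplus>\<^bsub>V i\<^esub> g i),
      smult = (\<lambda>a f. \<lambda>i\<in>I. a \<odot>\<^bsub>V i\<^esub> f i)\<rparr>"

definition direct_sum :: "'i set \<Rightarrow> ('i \<Rightarrow> ('k, 'm) module) \<Rightarrow> ('k, 'i \<Rightarrow> 'm) module" where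
  "direct_sum I V =
     pointwise_module I V {f \<in> \<Pi>\<^sub>E i\<in>I. carrier (V i). finite {i \<in> I. f i \<noteq> \<zero>\<^bsub>V i\<^esub>}}"


section \<open>Linear categories\<close>

text \<open>\<open>Mor C x y\<close> is the space of morphisms from \<open>x\<close> to \<open>y\<close>, and \<open>Comp C x y z g f\<close> is the composite
  of \<open>f\<close> from \<open>x\<close> to \<open>y\<close> followed by \<open>g\<close> from \<open>y\<close> to \<open>z\<close>. Composition carries the objects as
  arguments because different morphism spaces may share elements.\<close>

record ('k, 'o, 'm) kcat =
  Obj :: "'o set"
  Mor :: "'o \<Rightarrow> 'o \<Rightarrow> ('k, 'm) module"
  Comp :: "'o \<Rightarrow> 'o \<Rightarrow> 'o \<Rightarrow> 'm \<Rightarrow> 'm \<Rightarrow> 'm"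
  Ident :: "'o \<Rightarrow> 'm"

locale k_category = field k for k :: "('k, 'r) ring_scheme" (structure) +
  fixes C :: "('k, 'o, 'm) kcat"
  assumes Mor_module: "\<lbrakk>x \<in> Obj C; y \<in> Obj C\<rbrakk> \<Longrightarrow> module k (Mor C x y)"
    and Ident_closed: "x \<in> Obj C \<Longrightarrow> Ident C x \<in> carrier (Mor C x x)"
    and Comp_linear_right:
      "\<lbrakk>x \<in> Obj C; y \<in> Obj C; z \<in> Obj C; g \<in> carrier (Mor C y z)\<rbrakk>
        \<Longrightarrow> linear_map k (Mor C x y) (Mor C x z) (\<lambda>f. Comp C x y z g f)"
    and Comp_linear_left:
      "\<lbrakk>x \<in> Obj C; y \<in> Obj C; z \<in> Obj C; f \<in> carrier (Mor C x y)\<rbrakk>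
        \<Longrightarrow> linear_map k (Mor C y z) (Mor C x z) (\<lambda>g. Comp C x y z g f)"
    and Comp_Ident_left:
      "\<lbrakk>x \<in> Obj C; y \<in> Obj C; f \<in> carrier (Mor C x y)\<rbrakk> \<Longrightarrow> Comp C x y y (Ident C y) f = f"
    and Comp_Ident_right:
      "\<lbrakk>x \<in> Obj C; y \<in> Obj C; f \<in> carrier (Mor C x y)\<rbrakk> \<Longrightarrow> Comp C x x y f (Ident C x) = f"
    and Comp_assoc:
      "\<lbrakk>w \<in> Obj C; x \<in> Obj C; y \<in> Obj C; z \<in> Obj C;
        f \<in> carrier (Mor C w x); g \<in> carrier (Mor C x y); h \<in> carrier (Mor C y z)\<rbrakk>
        \<Longrightarrow> Comp C w y z h (Comp C w x y g f) = Comp C w x z (Comp C x y z h g) f"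

definition is_iso :: "('k, 'o, 'm) kcat \<Rightarrow> 'o \<Rightarrow> 'o \<Rightarrow> 'm \<Rightarrow> bool" where
  "is_iso C x y f \<longleftrightarrow>
     f \<in> carrier (Mor C x y) \<and>
     (\<exists>g\<in>carrier (Mor C y x). Comp C x y x g f = Ident C x \<and> Comp C y x y f g = Ident C y)"


section \<open>Linear functors, natural transformations, equivalences\<close>

record ('o, 'm, 'p, 'n) kfunctor =
  on_obj :: "'o \<Rightarrow> 'p"
  on_mor :: "'o \<Rightarrow> 'o \<Rightarrow> 'm \<Rightarrow> 'n"

definition linear_functor ::
  "('k, 'r) ring_scheme \<Rightarrow> ('k, 'o, 'm) kcat \<Rightarrow> ('k, 'p, 'n) kcat \<Rightarrow> ('o, 'm, 'p, 'n) kfunctor \<Rightarrow> bool"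
  where
  "linear_functor k C D F \<longleftrightarrow>
     on_obj F \<in> Obj C \<rightarrow> Obj D \<and>
     (\<forall>x\<in>Obj C. \<forall>y\<in>Obj C.
        linear_map k (Mor C x y) (Mor D (on_obj F x) (on_obj F y)) (on_mor F x y)) \<and>
     (\<forall>x\<in>Obj C. on_mor F x x (Ident C x) = Ident D (on_obj F x)) \<and>
     (\<forall>x\<in>Obj C. \<forall>y\<in>Obj C. \<forall>z\<in>Obj C. \<forall>f\<in>carrier (Mor C x y). \<forall>g\<in>carrier (Mor C y z).
        on_mor F x z (Comp C x y z g f) =
          Comp D (on_obj F x) (on_obj F y) (on_obj F z) (on_mor F y z g) (on_mor F x y f))"

definition id_functor :: "('o, 'm, 'o, 'm) kfunctor" where
  "id_functor = \<lparr>on_obj = (\<lambda>x. x), on_mor = (\<lambda>x y f. f)\<rparr>"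

definition comp_functor ::
  "('p, 'n, 'q, 'l) kfunctor \<Rightarrow> ('o, 'm, 'p, 'n) kfunctor \<Rightarrow> ('o, 'm, 'q, 'l) kfunctor" where
  "comp_functor G F =
     \<lparr>on_obj = (\<lambda>x. on_obj G (on_obj F x)),
      on_mor = (\<lambda>x y f. on_mor G (on_obj F x) (on_obj F y) (on_mor F x y f))\<rparr>"

definition nat_trans ::
  "('k, 'o, 'm) kcat \<Rightarrow> ('k, 'p, 'n) kcat \<Rightarrow> ('o, 'm, 'p, 'n) kfunctor \<Rightarrow> ('o, 'm, 'p, 'n) kfunctor
    \<Rightarrow> ('o \<Rightarrow> 'n) set" where
  "nat_trans C D F G =
     {\<eta> \<in> \<Pi>\<^sub>E x\<in>Obj C. carrier (Mor D (on_obj F x) (on_obj G x)).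
        \<forall>x\<in>Obj C. \<forall>y\<in>Obj C. \<forall>f\<in>carrier (Mor C x y).
          Comp D (on_obj F x) (on_obj F y) (on_obj G y) (\<eta> y) (on_mor F x y f) =
          Comp D (on_obj F x) (on_obj G x) (on_obj G y) (on_mor G x y f) (\<eta> x)}"

definition naturally_isomorphic ::
  "('k, 'o, 'm) kcat \<Rightarrow> ('k, 'p, 'n) kcat \<Rightarrow> ('o, 'm, 'p, 'n) kfunctor \<Rightarrow> ('o, 'm, 'p, 'n) kfunctor
    \<Rightarrow> bool" where
  "naturally_isomorphic C D F G \<longleftrightarrow>
     (\<exists>\<eta>\<in>nat_trans C D F G. \<forall>x\<in>Obj C. is_iso D (on_obj F x) (on_obj G x) (\<eta> x))"

definition k_equivalent ::
  "('k, 'r) ring_scheme \<Rightarrow> ('k, 'o, 'm) kcat \<Rightarrow> ('k, 'p, 'n) kcat \<Rightarrow> bool" where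
  "k_equivalent k C D \<longleftrightarrow>
     k_category k C \<and> k_category k D \<and>
     (\<exists>F G. linear_functor k C D F \<and> linear_functor k D C G \<and>
        naturally_isomorphic C C (comp_functor G F) id_functor \<and>
        naturally_isomorphic D D (comp_functor F G) id_functor)"


section \<open>Left modules and Morita equivalence\<close>

text \<open>Morphisms of \<open>vect k\<close> are linear maps, normalised to be \<open>undefined\<close> off the carrier of the
  source so that equality of morphisms is equality of HOL functions.\<close>

definition vect :: "('k, 'r) ring_scheme \<Rightarrow> ('k, ('k, 'v) module, 'v \<Rightarrow> 'v) kcat" where
  "vect k =
     \<lparr>Obj = {V. module k V},
      Mor = (\<lambda>V W. pointwise_module (carrier V) (\<lambda>_. W)
                     {f \<in> extensional (carrier V). linear_map k V W f}),
      Comp = (\<lambda>U V W g f. compose (carrier U) g f),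
      Ident = (\<lambda>V. \<lambda>v\<in>carrier V. v)\<rparr>"

definition functor_category ::
  "('k, 'r) ring_scheme \<Rightarrow> ('k, 'o, 'm) kcat \<Rightarrow> ('k, 'p, 'n) kcat
    \<Rightarrow> ('k, ('o, 'm, 'p, 'n) kfunctor, 'o \<Rightarrow> 'n) kcat" where
  "functor_category k C D =
     \<lparr>Obj = {F. linear_functor k C D F},
      Mor = (\<lambda>F G. pointwise_module (Obj C) (\<lambda>x. Mor D (on_obj F x) (on_obj G x))
                     (nat_trans C D F G)),
      Comp = (\<lambda>F G H \<theta> \<eta>. \<lambda>x\<in>Obj C. Comp D (on_obj F x) (on_obj G x) (on_obj H x) (\<theta> x) (\<eta> x)),
      Ident = (\<lambda>F. \<lambda>x\<in>Obj C. Ident D (on_obj F x))\<rparr>"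

text \<open>HOL has no type of all vector spaces: the spaces considered are those whose carrier is a set
  of elements of a type \<open>'v\<close>, which plays the role of the universe. It has to be infinite, since the
  spaces carried by a finite type are not closed under finite direct sums, even up to isomorphism.\<close>

definition left_modules ::
  "'v::infinite itself \<Rightarrow> ('k, 'r) ring_scheme \<Rightarrow> ('k, 'o, 'm) kcat
    \<Rightarrow> ('k, ('o, 'm, ('k, 'v) module, 'v \<Rightarrow> 'v) kfunctor, 'o \<Rightarrow> 'v \<Rightarrow> 'v) kcat" where
  "left_modules _ k C = functor_category k C (vect k)"

definition morita_equivalent ::
  "'v::infinite itself \<Rightarrow> ('k, 'r) ring_scheme \<Rightarrow> ('k, 'o, 'm) kcat \<Rightarrow> ('k, 'p, 'n) kcat \<Rightarrow> bool" where
  "morita_equivalent U k C D \<longleftrightarrow>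
     k_category k C \<and> k_category k D \<and>
     k_equivalent k (left_modules U k C) (left_modules U k D)"


section \<open>Contracted categories\<close>

definition indexed_partition :: "'o set \<Rightarrow> 'i set \<Rightarrow> ('i \<Rightarrow> 'o set) \<Rightarrow> bool" where
  "indexed_partition A I E \<longleftrightarrow>
     (\<Union>i\<in>I. E i) = A \<and> disjoint_family_on E I \<and> (\<forall>i\<in>I. E i \<noteq> {})"

text \<open>A morphism from \<open>i\<close> to \<open>j\<close> is a matrix whose entry at \<open>(y, x)\<close>, with \<open>y\<close> in \<open>E j\<close> and \<open>x\<close> in
  \<open>E i\<close>, is a morphism from \<open>x\<close> to \<open>y\<close>.\<close>

definition contracted_category ::
  "('k, 'o, 'm) kcat \<Rightarrow> 'i set \<Rightarrow> ('i \<Rightarrow> 'o set) \<Rightarrow> ('k, 'i, 'o \<times> 'o \<Rightarrow> 'm) kcat" where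
  "contracted_category D I E =
     \<lparr>Obj = I,
      Mor = (\<lambda>i j. direct_sum (E j \<times> E i) (\<lambda>(y, x). Mor D x y)),
      Comp = (\<lambda>i j l g f. \<lambda>(z, x)\<in>E l \<times> E i.
                finsum (Mor D x z) (\<lambda>y. Comp D x y z (g (z, y)) (f (y, x))) (E j)),
      Ident = (\<lambda>i. \<lambda>(y, x)\<in>E i \<times> E i. if y = x then Ident D x else \<zero>\<^bsub>Mor D x y\<^esub>)\<rparr>"

end

theory Submission
  imports Defs
begin

text \<open>The contracted category contains the matrices with a single nonzero entry, hence for every
  object \<open>x\<close> of \<open>D\<close> an idempotent \<open>idem x\<close>; the idempotents of one block are orthogonal and add up to
  the identity. A module \<open>N\<close> over the contracted category thus decomposes as
  \<open>N i = (\<Oplus>x\<in>E i. N (idem x) (N i))\<close>, and \<open>x \<mapsto> N (idem x) (N (block x))\<close> is a \<open>D\<close>-module, the corner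
  of \<open>N\<close>. Passing to corners is fully faithful because of the decomposition. It is essentially
  surjective because a \<open>D\<close>-module \<open>M\<close> is the corner of \<open>i \<mapsto> (\<Oplus>x\<in>E i. M x)\<close>, on which matrices act by
  matrix multiplication; as the universe \<open>'v\<close> is infinite, this finite direct sum can be carried by
  a subset of \<open>'v\<close>.\<close>

section \<open>Linear maps and finite sums\<close>

text \<open>The equivalence is obtained from a criterion on one functor because an inverse involves
  choices: a direct sum of spaces carried by subsets of \<open>'v\<close> is carried by functions
  \<open>'o \<Rightarrow> 'v\<close>, and bringing it back into \<open>'v\<close> takes an injection
  chosen separately for each block. Corners are subsets of spaces already present, so passing to
  corners is free of choices, and the injections stay confined to the objectwise statement of
  essential surjectivity. Corners are also what makes restriction to \<open>D\<close> functorial.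
  Sending a morphism to its single-entry matrix respects composition but turns identities into
  idempotents; cutting down to the fixed vectors of these idempotents repairs exactly this. Full
  faithfulness uses the decomposition in two forms: a vector is determined by its projections to the
  corners, and cutting a matrix by one idempotent on each side leaves one entry, a morphism of
  \<open>D\<close>. Finiteness of the blocks makes the identity matrix a sum of idempotents and the
  direct sums embeddable in any infinite \<open>'v\<close>.\<close>

lemma linear_mapI:
  assumes "\<And>v. v \<in> carrier V \<Longrightarrow> f v \<in> carrier W"
    and "\<And>u v. \<lbrakk>u \<in> carrier V; v \<in> carrier V\<rbrakk> \<Longrightarrow> f (u \<oplus>\<^bsub>V\<^esub> v) = f u \<oplus>\<^bsub>W\<^esub> f v"
    and "\<And>a v. \<lbrakk>a \<in> carrier k; v \<in> carrier V\<rbrakk> \<Longrightarrow> f (a \<odot>\<^bsub>V\<^esub> v) = a \<odot>\<^bsub>W\<^esub> f v"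
  shows "linear_map k V W f"
  using assms by (auto simp: linear_map_def)

lemma
  assumes "linear_map k V W f"
  shows linear_map_closed: "v \<in> carrier V \<Longrightarrow> f v \<in> carrier W"
    and linear_map_add:
      "\<lbrakk>u \<in> carrier V; v \<in> carrier V\<rbrakk> \<Longrightarrow> f (u \<oplus>\<^bsub>V\<^esub> v) = f u \<oplus>\<^bsub>W\<^esub> f v"
    and linear_map_smult:
      "\<lbrakk>a \<in> carrier k; v \<in> carrier V\<rbrakk> \<Longrightarrow> f (a \<odot>\<^bsub>V\<^esub> v) = a \<odot>\<^bsub>W\<^esub> f v"
  using assms by (auto simp: linear_map_def)

lemma linear_map_zero:
  assumes "module k V" "module k W" "linear_map k V W f"
  shows "f \<zero>\<^bsub>V\<^esub> = \<zero>\<^bsub>W\<^esub>"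
proof -
  interpret V: module k V by fact
  interpret W: module k W by fact
  have "f \<zero>\<^bsub>V\<^esub> = f (\<zero>\<^bsub>k\<^esub> \<odot>\<^bsub>V\<^esub> \<zero>\<^bsub>V\<^esub>)"
    by simp
  also have "\<dots> = \<zero>\<^bsub>k\<^esub> \<odot>\<^bsub>W\<^esub> f \<zero>\<^bsub>V\<^esub>"
    using assms(3) by (rule linear_map_smult) auto
  finally show ?thesis
    using linear_map_closed[OF assms(3) V.zero_closed] by simp
qed

lemma linear_map_finsum:
  assumes "module k V" "module k W" "linear_map k V W f" "g \<in> A \<rightarrow> carrier V"
  shows "f (finsum V g A) = finsum W (\<lambda>a. f (g a)) A"
proof -
  interpret V: module k V by fact
  interpret W: module k W by fact
  show ?thesis
    using assms(4)
  \<comment> \<open>Over an infinite set \<open>finsum\<close> is zero by default, so that case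
    reduces to preservation of zero.\<close>
  proof (induction A rule: infinite_finite_induct)
    case (insert a A)
    then have "g \<in> A \<rightarrow> carrier V" "g a \<in> carrier V" "(\<lambda>a. f (g a)) \<in> A \<rightarrow> carrier W"
        "f (g a) \<in> carrier W"
      using linear_map_closed[OF assms(3)] by auto
    with insert show ?case
      by (simp add: linear_map_add[OF assms(3)])
  qed (simp_all add: linear_map_zero[OF assms(1-3)])
qed

lemma linear_map_comp:
  assumes "linear_map k U V f" "linear_map k V W g"
  shows "linear_map k U W (\<lambda>u. g (f u))"
  using assms by (auto simp: linear_map_def Pi_iff)

lemma linear_map_cong:
  assumes "module k V" "\<And>v. v \<in> carrier V \<Longrightarrow> f v = g v"
  shows "linear_map k V W f \<longleftrightarrow> linear_map k V W g"
proof -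
  interpret V: module k V by fact
  show ?thesis
    using assms(2) by (simp add: linear_map_def Pi_iff)
qed

text \<open>Morphisms of \<open>vect\<close> are normalised to be \<open>undefined\<close> off the
  carrier; this lets their linearity be checked on the unrestricted function.\<close>

lemma linear_map_restrict:
  assumes "module k V"
  shows "linear_map k V W (restrict f (carrier V)) \<longleftrightarrow> linear_map k V W f"
  by (rule linear_map_cong[OF assms]) simp

lemma linear_map_finsum_pointwise:
  assumes "module k V" "module k W" "\<And>a. a \<in> A \<Longrightarrow> linear_map k V W (h a)"
  shows "linear_map k V W (\<lambda>v. finsum W (\<lambda>a. h a v) A)"
proof -
  interpret V: module k V by fact
  interpret W: module k W by fact
  show ?thesis
    using assms(3)
  proof (induction A rule: infinite_finite_induct)
    case (insert a A)
    then have lin: "linear_map k V W (\<lambda>v. finsum W (\<lambda>a. h a v) A)" "linear_map k V W (h a)"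
      by auto
    have *: "finsum W (\<lambda>a. h a v) (insert a A) = h a v \<oplus>\<^bsub>W\<^esub> finsum W (\<lambda>a. h a v) A"
      if "v \<in> carrier V" for v
      using insert that linear_map_closed by (subst W.finsum_insert) fastforce+
    have "linear_map k V W (\<lambda>v. h a v \<oplus>\<^bsub>W\<^esub> finsum W (\<lambda>a. h a v) A)"
      by (rule linear_mapI)
        (simp_all add: linear_map_closed[OF lin(1)] linear_map_closed[OF lin(2)]
          linear_map_add[OF lin(1)] linear_map_add[OF lin(2)] linear_map_smult[OF lin(1)]
          linear_map_smult[OF lin(2)] W.M.a_ac W.smult_r_distr)
    then show ?case
      by (subst linear_map_cong[OF assms(1) *])
  qed (auto intro: linear_mapI)
qed

text \<open>Collapses matrix products in which one factor is an identity or has a single nonzero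
  entry, and sums of projections of mutually orthogonal components.\<close>

lemma (in abelian_monoid) finsum_eq_single:
  assumes "finite A" "a \<in> A" "f a \<in> carrier G" "\<And>b. \<lbrakk>b \<in> A; b \<noteq> a\<rbrakk> \<Longrightarrow> f b = \<zero>"
  shows "finsum G f A = f a"
proof -
  have "finsum G f A = finsum G (\<lambda>b. if a = b then f a else \<zero>) A"
    using assms by (intro finsum_cong') auto
  also have "\<dots> = f a"
    using assms by (subst finsum_singleton[of a A "\<lambda>_. f a"]) auto
  finally show ?thesis .
qed

text \<open>Induction on \<open>A\<close>, the step being additivity of the sum over
  \<open>B\<close>. Associativity of the matrix product, and compatibility of the action of matrices
  on column vectors with that product, rest on this exchange.\<close>

lemma (in abelian_monoid) finsum_swap:
  assumes "finite A" "\<And>a b. \<lbrakk>a \<in> A; b \<in> B\<rbrakk> \<Longrightarrow> f a b \<in> carrier G"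
  shows "finsum G (\<lambda>a. finsum G (\<lambda>b. f a b) B) A = finsum G (\<lambda>b. finsum G (\<lambda>a. f a b) A) B"
  using assms
proof (induction A)
  case (insert a A)
  have "finsum G (\<lambda>b. finsum G (\<lambda>a. f a b) (insert a A)) B
      = finsum G (\<lambda>b. f a b \<oplus> finsum G (\<lambda>a. f a b) A) B"
    using insert by (intro finsum_cong') (auto simp: Pi_iff)
  also have "\<dots> = finsum G (\<lambda>b. f a b) B \<oplus> finsum G (\<lambda>b. finsum G (\<lambda>a. f a b) A) B"
    using insert by (intro finsum_addf) (auto simp: Pi_iff)
  finally show ?case
    using insert by (simp add: Pi_iff)
qed simp


section \<open>Pointwise modules\<close>

lemma pointwise_module_simps [simp]:
  "carrier (pointwise_module I V S) = S"
  "\<zero>\<^bsub>pointwise_module I V S\<^esub> = (\<lambda>i\<in>I. \<zero>\<^bsub>V i\<^esub>)"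
  "f \<oplus>\<^bsub>pointwise_module I V S\<^esub> g = (\<lambda>i\<in>I. f i \<oplus>\<^bsub>V i\<^esub> g i)"
  "a \<odot>\<^bsub>pointwise_module I V S\<^esub> f = (\<lambda>i\<in>I. a \<odot>\<^bsub>V i\<^esub> f i)"
  by (simp_all add: pointwise_module_def)

text \<open>Common source of the module structures on finite direct sums, on spaces of linear maps
  and on spaces of natural transformations. Additive inverses are multiples by minus one, so closure
  under \<open>smult\<close> provides them.\<close>

lemma module_pointwise_module:
  assumes "cring k"
    and V: "\<And>i. i \<in> I \<Longrightarrow> module k (V i)"
    and S: "\<And>f. f \<in> S \<Longrightarrow> f \<in> (\<Pi>\<^sub>E i\<in>I. carrier (V i))"
    and zero: "(\<lambda>i\<in>I. \<zero>\<^bsub>V i\<^esub>) \<in> S"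
    and add: "\<And>f g. \<lbrakk>f \<in> S; g \<in> S\<rbrakk> \<Longrightarrow> (\<lambda>i\<in>I. f i \<oplus>\<^bsub>V i\<^esub> g i) \<in> S"
    and smult: "\<And>a f. \<lbrakk>a \<in> carrier k; f \<in> S\<rbrakk> \<Longrightarrow> (\<lambda>i\<in>I. a \<odot>\<^bsub>V i\<^esub> f i) \<in> S"
  shows "module k (pointwise_module I V S)"
proof -
  interpret k: cring k by fact
  have closed: "f i \<in> carrier (V i)" if "f \<in> S" "i \<in> I" for f i
    using S[OF that(1)] that(2) by auto
  have ext: "f \<in> extensional I" if "f \<in> S" for f
    using S[OF that] by (auto simp: PiE_def)
  have grp: "abelian_group (V i)" if "i \<in> I" for i
    using V[OF that] by (rule module.axioms)
  show ?thesis
  proof (rule moduleI)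
    show "cring k" by fact
    show "abelian_group (pointwise_module I V S)"
    proof (rule abelian_groupI)
      fix f assume f: "f \<in> carrier (pointwise_module I V S)"
      have "\<ominus>\<^bsub>k\<^esub> \<one>\<^bsub>k\<^esub> \<odot>\<^bsub>V i\<^esub> f i \<oplus>\<^bsub>V i\<^esub> f i = \<zero>\<^bsub>V i\<^esub>" if i: "i \<in> I" for i
      proof -
        interpret module k "V i" using V[OF i] .
        show ?thesis
          using f closed[of f i] i by (simp add: smult_l_minus M.l_neg)
      qed
      then have "(\<lambda>i\<in>I. \<ominus>\<^bsub>k\<^esub> \<one>\<^bsub>k\<^esub> \<odot>\<^bsub>V i\<^esub> f i) \<oplus>\<^bsub>pointwise_module I V S\<^esub> f = \<zero>\<^bsub>pointwise_module I V S\<^esub>"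
        by (auto intro!: restrict_ext)
      then show "\<exists>g\<in>carrier (pointwise_module I V S).
          g \<oplus>\<^bsub>pointwise_module I V S\<^esub> f = \<zero>\<^bsub>pointwise_module I V S\<^esub>"
        using f by (intro bexI[of _ "\<lambda>i\<in>I. \<ominus>\<^bsub>k\<^esub> \<one>\<^bsub>k\<^esub> \<odot>\<^bsub>V i\<^esub> f i"]) (auto intro!: smult)
    next
      fix f assume "f \<in> carrier (pointwise_module I V S)"
      then show "\<zero>\<^bsub>pointwise_module I V S\<^esub> \<oplus>\<^bsub>pointwise_module I V S\<^esub> f = f"
        using closed grp ext
        by (auto intro!: extensionalityI[of _ I] simp: abelian_monoid.l_zero abelian_group.axioms(1))
    next
      fix f g assume "f \<in> carrier (pointwise_module I V S)" "g \<in> carrier (pointwise_module I V S)"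
      then show "f \<oplus>\<^bsub>pointwise_module I V S\<^esub> g = g \<oplus>\<^bsub>pointwise_module I V S\<^esub> f"
        using closed grp
        by (auto intro!: restrict_ext simp: abelian_monoid.a_comm abelian_group.axioms(1))
    next
      fix f g h
      assume "f \<in> carrier (pointwise_module I V S)" "g \<in> carrier (pointwise_module I V S)"
        "h \<in> carrier (pointwise_module I V S)"
      then show "(f \<oplus>\<^bsub>pointwise_module I V S\<^esub> g) \<oplus>\<^bsub>pointwise_module I V S\<^esub> h
          = f \<oplus>\<^bsub>pointwise_module I V S\<^esub> (g \<oplus>\<^bsub>pointwise_module I V S\<^esub> h)"
        using closed grp
        by (auto intro!: restrict_ext simp: abelian_monoid.a_assoc abelian_group.axioms(1))
    qed (auto intro: zero add)
  qed (use V closed ext in \<open>auto intro!: restrict_ext extensionalityI[of _ I] smult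
          simp: module.smult_l_distr module.smult_r_distr[OF V] module.smult_assoc1 module.smult_one\<close>)
qed

lemma direct_sum_finite:
  assumes "finite I"
  shows "direct_sum I V = pointwise_module I V (\<Pi>\<^sub>E i\<in>I. carrier (V i))"
  using assms by (simp add: direct_sum_def)

lemma module_direct_sum_finite:
  assumes "cring k" "finite I" "\<And>i. i \<in> I \<Longrightarrow> module k (V i)"
  shows "module k (direct_sum I V)"
  unfolding direct_sum_finite[OF assms(2)]
proof (rule module_pointwise_module)
  fix f g assume "f \<in> (\<Pi>\<^sub>E i\<in>I. carrier (V i))" "g \<in> (\<Pi>\<^sub>E i\<in>I. carrier (V i))"
  then show "(\<lambda>i\<in>I. f i \<oplus>\<^bsub>V i\<^esub> g i) \<in> (\<Pi>\<^sub>E i\<in>I. carrier (V i))"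
    using assms(3) by (auto intro!: abelian_monoid.a_closed abelian_group.axioms(1) dest: module.axioms(2))
next
  show "(\<lambda>i\<in>I. \<zero>\<^bsub>V i\<^esub>) \<in> (\<Pi>\<^sub>E i\<in>I. carrier (V i))"
    using assms(3) by (auto intro!: abelian_monoid.zero_closed abelian_group.axioms(1) dest: module.axioms(2))
next
  fix a f assume "a \<in> carrier k" "f \<in> (\<Pi>\<^sub>E i\<in>I. carrier (V i))"
  then show "(\<lambda>i\<in>I. a \<odot>\<^bsub>V i\<^esub> f i) \<in> (\<Pi>\<^sub>E i\<in>I. carrier (V i))"
    using assms(3) by (auto intro!: module.smult_closed)
qed (use assms in auto)

lemma linear_map_direct_sum_entry:
  assumes "finite I" "i \<in> I"
  shows "linear_map k (direct_sum I V) (V i) (\<lambda>f. f i)"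
  using assms by (auto simp: linear_map_def direct_sum_finite)

text \<open>The finite direct sum is also a product, so a map into it is linear as soon as its
  coordinates are; extensionality makes the coordinates determine the value.\<close>

lemma linear_map_direct_sumI:
  assumes "finite I" "module k W" "\<And>w. w \<in> carrier W \<Longrightarrow> f w \<in> extensional I"
    and lin: "\<And>i. i \<in> I \<Longrightarrow> linear_map k W (V i) (\<lambda>w. f w i)"
  shows "linear_map k W (direct_sum I V) f"
proof -
  interpret W: module k W by fact
  have ext: "f w \<in> extensional I" if "w \<in> carrier W" for w
    using assms(3) that .
  show ?thesis
    unfolding direct_sum_finite[OF assms(1)]
    by (rule linear_mapI)
      (auto simp: PiE_iff ext linear_map_closed[OF lin] linear_map_add[OF lin]
        linear_map_smult[OF lin] intro!: extensionalityI[of _ I])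
qed


section \<open>Categories of vector spaces and of functors\<close>

lemma vect_simps [simp]:
  "Obj (vect k) = {V. module k V}"
  "carrier (Mor (vect k) V W) = {f \<in> extensional (carrier V). linear_map k V W f}"
  "f \<oplus>\<^bsub>Mor (vect k) V W\<^esub> g = (\<lambda>v\<in>carrier V. f v \<oplus>\<^bsub>W\<^esub> g v)"
  "a \<odot>\<^bsub>Mor (vect k) V W\<^esub> f = (\<lambda>v\<in>carrier V. a \<odot>\<^bsub>W\<^esub> f v)"
  "\<zero>\<^bsub>Mor (vect k) V W\<^esub> = (\<lambda>v\<in>carrier V. \<zero>\<^bsub>W\<^esub>)"
  "Comp (vect k) U V W h g = compose (carrier U) h g"
  "Ident (vect k) V = (\<lambda>v\<in>carrier V. v)"
  by (simp_all add: vect_def)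

lemma k_category_vect:
  fixes k :: "('k, 'r) ring_scheme"
  assumes "field k"
  shows "k_category k (vect k :: ('k, ('k, 'v) module, 'v \<Rightarrow> 'v) kcat)"
proof -
  interpret field k by fact
  have lin_ext: "(\<lambda>v\<in>carrier V. h v) \<in> {f \<in> extensional (carrier V). linear_map k V W f}"
    if "module k V" "linear_map k V W h" for V :: "('k, 'v) module" and W :: "('k, 'v) module" and h
    using that by (simp add: linear_map_restrict)
  show ?thesis
  proof (intro k_category.intro k_category_axioms.intro assms)
    fix V W :: "('k, 'v) module" assume VW: "V \<in> Obj (vect k)" "W \<in> Obj (vect k)"
    interpret V: module k V using VW by simp
    interpret W: module k W using VW by simp
    show "module k (Mor (vect k) V W)"
      unfolding vect_def kcat.simps
    proof (rule module_pointwise_module)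
      fix f g
      assume *: "f \<in> {f \<in> extensional (carrier V). linear_map k V W f}"
        "g \<in> {f \<in> extensional (carrier V). linear_map k V W f}"
      then have "linear_map k V W f" "linear_map k V W g" by auto
      note lin = linear_map_add[OF this(1)] linear_map_add[OF this(2)] linear_map_smult[OF this(1)]
        linear_map_smult[OF this(2)] linear_map_closed[OF this(1)] linear_map_closed[OF this(2)]
      show "(\<lambda>v\<in>carrier V. f v \<oplus>\<^bsub>W\<^esub> g v) \<in> {f \<in> extensional (carrier V). linear_map k V W f}"
        by (intro lin_ext linear_mapI V.module_axioms)
           (auto simp: lin W.M.a_ac W.smult_r_distr)
    next
      fix a f
      assume *: "a \<in> carrier k" "f \<in> {f \<in> extensional (carrier V). linear_map k V W f}"
      then have "linear_map k V W f" by auto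
      note lin = linear_map_add[OF this(1)] linear_map_smult[OF this(1)] linear_map_closed[OF this(1)]
      \<comment> \<open>Compatibility of a multiple of \<open>f\<close> with scalars is where
        commutativity of \<open>k\<close> enters, through \<open>m_comm\<close>.\<close>
      show "(\<lambda>v\<in>carrier V. a \<odot>\<^bsub>W\<^esub> f v) \<in> {f \<in> extensional (carrier V). linear_map k V W f}"
        using *(1)
        by (intro lin_ext linear_mapI V.module_axioms)
           (auto simp: lin W.smult_r_distr W.smult_assoc1[symmetric] m_comm)
    next
      show "(\<lambda>v\<in>carrier V. \<zero>\<^bsub>W\<^esub>) \<in> {f \<in> extensional (carrier V). linear_map k V W f}"
        by (intro lin_ext linear_mapI V.module_axioms) auto
    qed (auto simp: PiE_iff linear_map_closed intro: W.module_axioms is_cring)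
  next
    fix V :: "('k, 'v) module" assume "V \<in> Obj (vect k)"
    then show "Ident (vect k) V \<in> carrier (Mor (vect k) V V)"
      unfolding vect_simps by (intro lin_ext linear_mapI) auto
  next
    fix U V W :: "('k, 'v) module" and g
    assume *: "U \<in> Obj (vect k)" "V \<in> Obj (vect k)" "W \<in> Obj (vect k)" "g \<in> carrier (Mor (vect k) V W)"
    then show "linear_map k (Mor (vect k) U V) (Mor (vect k) U W) (Comp (vect k) U V W g)"
      by (intro linear_mapI)
         (auto simp: compose_def linear_map_restrict linear_map_comp linear_map_add linear_map_smult
             linear_map_closed intro!: restrict_ext)
  next
    fix U V W :: "('k, 'v) module" and f
    assume *: "U \<in> Obj (vect k)" "V \<in> Obj (vect k)" "W \<in> Obj (vect k)" "f \<in> carrier (Mor (vect k) U V)"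
    then show "linear_map k (Mor (vect k) V W) (Mor (vect k) U W) (\<lambda>g. Comp (vect k) U V W g f)"
      by (intro linear_mapI)
         (auto simp: compose_def linear_map_restrict linear_map_comp linear_map_closed intro!: restrict_ext)
  next
    fix V W :: "('k, 'v) module" and f
    assume "f \<in> carrier (Mor (vect k) V W)"
    then show "Comp (vect k) V W W (Ident (vect k) W) f = f" "Comp (vect k) V V W f (Ident (vect k) V) = f"
      by (auto simp: compose_def linear_map_closed intro!: extensionalityI[of _ "carrier V"])
  next
    fix T U V W :: "('k, 'v) module" and f g h
    assume "f \<in> carrier (Mor (vect k) T U)"
    then show "Comp (vect k) T V W h (Comp (vect k) T U V g f) = Comp (vect k) T U W (Comp (vect k) U V W h g) f"
      by (auto simp: compose_def linear_map_closed intro!: restrict_ext)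
  qed
qed

context k_category
begin

lemma
  assumes "x \<in> Obj C" "y \<in> Obj C" "z \<in> Obj C"
  shows Comp_closed: "\<lbrakk>f \<in> carrier (Mor C x y); g \<in> carrier (Mor C y z)\<rbrakk>
      \<Longrightarrow> Comp C x y z g f \<in> carrier (Mor C x z)"
    and Comp_add_left:
      "\<lbrakk>f \<in> carrier (Mor C x y); g \<in> carrier (Mor C y z); h \<in> carrier (Mor C y z)\<rbrakk>
      \<Longrightarrow> Comp C x y z (g \<oplus>\<^bsub>Mor C y z\<^esub> h) f = Comp C x y z g f \<oplus>\<^bsub>Mor C x z\<^esub> Comp C x y z h f"
    and Comp_add_right:
      "\<lbrakk>f \<in> carrier (Mor C x y); f' \<in> carrier (Mor C x y); g \<in> carrier (Mor C y z)\<rbrakk>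
      \<Longrightarrow> Comp C x y z g (f \<oplus>\<^bsub>Mor C x y\<^esub> f') = Comp C x y z g f \<oplus>\<^bsub>Mor C x z\<^esub> Comp C x y z g f'"
    and Comp_smult_left:
      "\<lbrakk>f \<in> carrier (Mor C x y); g \<in> carrier (Mor C y z); a \<in> carrier k\<rbrakk>
      \<Longrightarrow> Comp C x y z (a \<odot>\<^bsub>Mor C y z\<^esub> g) f = a \<odot>\<^bsub>Mor C x z\<^esub> Comp C x y z g f"
    and Comp_smult_right:
      "\<lbrakk>f \<in> carrier (Mor C x y); g \<in> carrier (Mor C y z); a \<in> carrier k\<rbrakk>
      \<Longrightarrow> Comp C x y z g (a \<odot>\<^bsub>Mor C x y\<^esub> f) = a \<odot>\<^bsub>Mor C x z\<^esub> Comp C x y z g f"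
  using Comp_linear_left[OF assms] Comp_linear_right[OF assms]
  by (auto dest: linear_map_closed linear_map_add linear_map_smult)

lemma
  assumes "x \<in> Obj C" "y \<in> Obj C" "z \<in> Obj C"
  shows Comp_zero_left: "f \<in> carrier (Mor C x y) \<Longrightarrow> Comp C x y z \<zero>\<^bsub>Mor C y z\<^esub> f = \<zero>\<^bsub>Mor C x z\<^esub>"
    and Comp_zero_right: "g \<in> carrier (Mor C y z) \<Longrightarrow> Comp C x y z g \<zero>\<^bsub>Mor C x y\<^esub> = \<zero>\<^bsub>Mor C x z\<^esub>"
    and Comp_finsum_left:
      "\<lbrakk>f \<in> carrier (Mor C x y); s \<in> A \<rightarrow> carrier (Mor C y z)\<rbrakk>
      \<Longrightarrow> Comp C x y z (finsum (Mor C y z) s A) f = finsum (Mor C x z) (\<lambda>a. Comp C x y z (s a) f) A"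
    and Comp_finsum_right:
      "\<lbrakk>g \<in> carrier (Mor C y z); t \<in> A \<rightarrow> carrier (Mor C x y)\<rbrakk>
      \<Longrightarrow> Comp C x y z g (finsum (Mor C x y) t A) = finsum (Mor C x z) (\<lambda>a. Comp C x y z g (t a)) A"
  using linear_map_zero[OF Mor_module Mor_module Comp_linear_left] assms
    linear_map_zero[OF Mor_module Mor_module Comp_linear_right]
    linear_map_finsum[OF Mor_module Mor_module Comp_linear_left]
    linear_map_finsum[OF Mor_module Mor_module Comp_linear_right]
  by simp_all

lemma Mor_abelian_group: "\<lbrakk>x \<in> Obj C; y \<in> Obj C\<rbrakk> \<Longrightarrow> abelian_group (Mor C x y)"
  using Mor_module by (rule module.axioms)

lemma Mor_abelian_monoid: "\<lbrakk>x \<in> Obj C; y \<in> Obj C\<rbrakk> \<Longrightarrow> abelian_monoid (Mor C x y)"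
  using Mor_abelian_group by (rule abelian_group.axioms)

end

lemma
  assumes "linear_functor k C D F"
  shows linear_functor_obj: "x \<in> Obj C \<Longrightarrow> on_obj F x \<in> Obj D"
    and linear_functor_linear: "\<lbrakk>x \<in> Obj C; y \<in> Obj C\<rbrakk>
      \<Longrightarrow> linear_map k (Mor C x y) (Mor D (on_obj F x) (on_obj F y)) (on_mor F x y)"
    and linear_functor_closed: "\<lbrakk>x \<in> Obj C; y \<in> Obj C; f \<in> carrier (Mor C x y)\<rbrakk>
      \<Longrightarrow> on_mor F x y f \<in> carrier (Mor D (on_obj F x) (on_obj F y))"
    and linear_functor_Ident: "x \<in> Obj C \<Longrightarrow> on_mor F x x (Ident C x) = Ident D (on_obj F x)"
    and linear_functor_Comp:
      "\<lbrakk>x \<in> Obj C; y \<in> Obj C; z \<in> Obj C; f \<in> carrier (Mor C x y); g \<in> carrier (Mor C y z)\<rbrakk>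
      \<Longrightarrow> on_mor F x z (Comp C x y z g f) =
          Comp D (on_obj F x) (on_obj F y) (on_obj F z) (on_mor F y z g) (on_mor F x y f)"
  using assms by (auto simp: linear_functor_def intro: linear_map_closed)

lemma linear_functorI:
  assumes "\<And>x. x \<in> Obj C \<Longrightarrow> on_obj F x \<in> Obj D"
    and "\<And>x y. \<lbrakk>x \<in> Obj C; y \<in> Obj C\<rbrakk>
      \<Longrightarrow> linear_map k (Mor C x y) (Mor D (on_obj F x) (on_obj F y)) (on_mor F x y)"
    and "\<And>x. x \<in> Obj C \<Longrightarrow> on_mor F x x (Ident C x) = Ident D (on_obj F x)"
    and "\<And>x y z f g.
      \<lbrakk>x \<in> Obj C; y \<in> Obj C; z \<in> Obj C; f \<in> carrier (Mor C x y); g \<in> carrier (Mor C y z)\<rbrakk>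
      \<Longrightarrow> on_mor F x z (Comp C x y z g f) =
          Comp D (on_obj F x) (on_obj F y) (on_obj F z) (on_mor F y z g) (on_mor F x y f)"
  shows "linear_functor k C D F"
  using assms by (simp add: linear_functor_def)

lemma functor_category_simps [simp]:
  "Obj (functor_category k C D) = {F. linear_functor k C D F}"
  "carrier (Mor (functor_category k C D) F G) = nat_trans C D F G"
  "\<eta> \<oplus>\<^bsub>Mor (functor_category k C D) F G\<^esub> \<theta>
    = (\<lambda>x\<in>Obj C. \<eta> x \<oplus>\<^bsub>Mor D (on_obj F x) (on_obj G x)\<^esub> \<theta> x)"
  "a \<odot>\<^bsub>Mor (functor_category k C D) F G\<^esub> \<eta>
    = (\<lambda>x\<in>Obj C. a \<odot>\<^bsub>Mor D (on_obj F x) (on_obj G x)\<^esub> \<eta> x)"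
  "Comp (functor_category k C D) F G H \<theta> \<eta>
    = (\<lambda>x\<in>Obj C. Comp D (on_obj F x) (on_obj G x) (on_obj H x) (\<theta> x) (\<eta> x))"
  "Ident (functor_category k C D) F = (\<lambda>x\<in>Obj C. Ident D (on_obj F x))"
  by (simp_all add: functor_category_def)

lemma
  assumes "\<eta> \<in> nat_trans C D F G"
  shows nat_trans_extensional: "\<eta> \<in> extensional (Obj C)"
    and nat_trans_closed: "x \<in> Obj C \<Longrightarrow> \<eta> x \<in> carrier (Mor D (on_obj F x) (on_obj G x))"
    and nat_trans_natural: "\<lbrakk>x \<in> Obj C; y \<in> Obj C; f \<in> carrier (Mor C x y)\<rbrakk>
      \<Longrightarrow> Comp D (on_obj F x) (on_obj F y) (on_obj G y) (\<eta> y) (on_mor F x y f) =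
          Comp D (on_obj F x) (on_obj G x) (on_obj G y) (on_mor G x y f) (\<eta> x)"
  using assms by (auto simp: nat_trans_def PiE_iff)

lemma restrict_nat_transI:
  assumes "\<And>x. x \<in> Obj C \<Longrightarrow> \<eta> x \<in> carrier (Mor D (on_obj F x) (on_obj G x))"
    and "\<And>x y f. \<lbrakk>x \<in> Obj C; y \<in> Obj C; f \<in> carrier (Mor C x y)\<rbrakk>
      \<Longrightarrow> Comp D (on_obj F x) (on_obj F y) (on_obj G y) (\<eta> y) (on_mor F x y f) =
          Comp D (on_obj F x) (on_obj G x) (on_obj G y) (on_mor G x y f) (\<eta> x)"
  shows "(\<lambda>x\<in>Obj C. \<eta> x) \<in> nat_trans C D F G"
  using assms by (auto simp: nat_trans_def)

text \<open>Pasting of the two naturality squares. Stated separately because linearity of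
  composition in each of its two arguments needs closedness.\<close>

lemma nat_trans_Comp:
  assumes "k_category k D" and F: "linear_functor k C D F" and G: "linear_functor k C D G"
    and H: "linear_functor k C D H" and \<eta>: "\<eta> \<in> nat_trans C D F G" and \<theta>: "\<theta> \<in> nat_trans C D G H"
  shows "(\<lambda>x\<in>Obj C. Comp D (on_obj F x) (on_obj G x) (on_obj H x) (\<theta> x) (\<eta> x)) \<in> nat_trans C D F H"
proof (rule restrict_nat_transI)
  interpret D: k_category k D by fact
  note [simp] = linear_functor_obj[OF F] linear_functor_obj[OF G] linear_functor_obj[OF H]
    linear_functor_closed[OF F] linear_functor_closed[OF G] linear_functor_closed[OF H]
    nat_trans_closed[OF \<eta>] nat_trans_closed[OF \<theta>] D.Comp_closed
  fix x assume x [simp]: "x \<in> Obj C"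
  show "Comp D (on_obj F x) (on_obj G x) (on_obj H x) (\<theta> x) (\<eta> x)
      \<in> carrier (Mor D (on_obj F x) (on_obj H x))"
    by simp
  fix y f assume [simp]: "y \<in> Obj C" "f \<in> carrier (Mor C x y)"
  let ?Fx = "on_obj F x" and ?Fy = "on_obj F y" and ?Gx = "on_obj G x" and ?Gy = "on_obj G y"
    and ?Hx = "on_obj H x" and ?Hy = "on_obj H y"
  have "Comp D ?Fx ?Fy ?Hy (Comp D ?Fy ?Gy ?Hy (\<theta> y) (\<eta> y)) (on_mor F x y f)
      = Comp D ?Fx ?Gy ?Hy (\<theta> y) (Comp D ?Fx ?Gx ?Gy (on_mor G x y f) (\<eta> x))"
    by (subst D.Comp_assoc[symmetric]) (simp_all add: nat_trans_natural[OF \<eta>])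
  also have "\<dots> = Comp D ?Fx ?Gx ?Hy (Comp D ?Gx ?Hx ?Hy (on_mor H x y f) (\<theta> x)) (\<eta> x)"
    by (subst D.Comp_assoc) (simp_all add: nat_trans_natural[OF \<theta>])
  also have "\<dots> = Comp D ?Fx ?Hx ?Hy (on_mor H x y f) (Comp D ?Fx ?Gx ?Hx (\<theta> x) (\<eta> x))"
    by (subst D.Comp_assoc) simp_all
  finally show "Comp D ?Fx ?Fy ?Hy (Comp D ?Fy ?Gy ?Hy (\<theta> y) (\<eta> y)) (on_mor F x y f)
      = Comp D ?Fx ?Hx ?Hy (on_mor H x y f) (Comp D ?Fx ?Gx ?Hx (\<theta> x) (\<eta> x))" .
qed

text \<open>Everything is inherited pointwise from \<open>D\<close>. Sums and multiples of natural
  transformations are natural because composition in \<open>D\<close> is bilinear, and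
  extensionality turns pointwise laws into equalities of functions.\<close>

lemma k_category_functor_category:
  assumes "k_category k D"
  shows "k_category k (functor_category k C D)"
proof -
  interpret D: k_category k D by fact
  show ?thesis
  proof (intro k_category.intro k_category_axioms.intro D.field_axioms)
    fix F G
    assume FG: "F \<in> Obj (functor_category k C D)" "G \<in> Obj (functor_category k C D)"
    then have F: "linear_functor k C D F" and G: "linear_functor k C D G" by auto
    note obj = linear_functor_obj[OF F] linear_functor_obj[OF G]
    note cl = linear_functor_closed[OF F] linear_functor_closed[OF G]
    show "module k (Mor (functor_category k C D) F G)"
      unfolding functor_category_def kcat.simps
    proof (rule module_pointwise_module)
      show "(\<lambda>x\<in>Obj C. \<zero>\<^bsub>Mor D (on_obj F x) (on_obj G x)\<^esub>) \<in> nat_trans C D F G"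
        by (rule restrict_nat_transI)
          (auto simp: obj cl D.Comp_zero_left D.Comp_zero_right
            intro!: abelian_monoid.zero_closed D.Mor_abelian_monoid)
    next
      fix \<eta> \<theta> assume \<eta>: "\<eta> \<in> nat_trans C D F G" and \<theta>: "\<theta> \<in> nat_trans C D F G"
      show "(\<lambda>x\<in>Obj C. \<eta> x \<oplus>\<^bsub>Mor D (on_obj F x) (on_obj G x)\<^esub> \<theta> x) \<in> nat_trans C D F G"
        by (rule restrict_nat_transI)
          (auto simp: obj cl D.Comp_add_left D.Comp_add_right nat_trans_closed[OF \<eta>]
            nat_trans_closed[OF \<theta>] nat_trans_natural[OF \<eta>] nat_trans_natural[OF \<theta>]
            intro!: abelian_monoid.a_closed D.Mor_abelian_monoid)
    next
      fix a \<eta> assume a: "a \<in> carrier k" and \<eta>: "\<eta> \<in> nat_trans C D F G"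
      show "(\<lambda>x\<in>Obj C. a \<odot>\<^bsub>Mor D (on_obj F x) (on_obj G x)\<^esub> \<eta> x) \<in> nat_trans C D F G"
        by (rule restrict_nat_transI)
          (auto simp: obj cl a D.Comp_smult_left D.Comp_smult_right nat_trans_closed[OF \<eta>]
            nat_trans_natural[OF \<eta>] intro!: module.smult_closed[OF D.Mor_module])
    qed (auto simp: PiE_iff obj nat_trans_extensional nat_trans_closed
        intro: D.Mor_module D.is_cring)
  next
    fix F assume "F \<in> Obj (functor_category k C D)"
    then have F: "linear_functor k C D F" by simp
    show "Ident (functor_category k C D) F \<in> carrier (Mor (functor_category k C D) F F)"
      unfolding functor_category_simps
      by (rule restrict_nat_transI)
        (auto simp: linear_functor_obj[OF F] linear_functor_closed[OF F] D.Ident_closed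
          D.Comp_Ident_left D.Comp_Ident_right)
  next
    fix F G H \<theta>
    assume "F \<in> Obj (functor_category k C D)" "G \<in> Obj (functor_category k C D)"
      "H \<in> Obj (functor_category k C D)" "\<theta> \<in> carrier (Mor (functor_category k C D) G H)"
    then have F: "linear_functor k C D F" and G: "linear_functor k C D G"
      and H: "linear_functor k C D H" and \<theta>: "\<theta> \<in> nat_trans C D G H" by auto
    note obj = linear_functor_obj[OF F] linear_functor_obj[OF G] linear_functor_obj[OF H]
    show "linear_map k (Mor (functor_category k C D) F G) (Mor (functor_category k C D) F H)
        (Comp (functor_category k C D) F G H \<theta>)"
    proof (rule linear_mapI)
      fix \<eta> assume "\<eta> \<in> carrier (Mor (functor_category k C D) F G)"
      then have \<eta>: "\<eta> \<in> nat_trans C D F G" by simp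
      show "Comp (functor_category k C D) F G H \<theta> \<eta> \<in> carrier (Mor (functor_category k C D) F H)"
        unfolding functor_category_simps by (rule nat_trans_Comp[OF assms F G H \<eta> \<theta>])
    qed (auto intro!: restrict_ext simp: obj nat_trans_closed nat_trans_closed[OF \<theta>]
        D.Comp_add_right D.Comp_smult_right)
  next
    fix F G H \<eta>
    assume "F \<in> Obj (functor_category k C D)" "G \<in> Obj (functor_category k C D)"
      "H \<in> Obj (functor_category k C D)" "\<eta> \<in> carrier (Mor (functor_category k C D) F G)"
    then have F: "linear_functor k C D F" and G: "linear_functor k C D G"
      and H: "linear_functor k C D H" and \<eta>: "\<eta> \<in> nat_trans C D F G" by auto
    note obj = linear_functor_obj[OF F] linear_functor_obj[OF G] linear_functor_obj[OF H]
    show "linear_map k (Mor (functor_category k C D) G H) (Mor (functor_category k C D) F H)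
        (\<lambda>\<theta>. Comp (functor_category k C D) F G H \<theta> \<eta>)"
    proof (rule linear_mapI)
      fix \<theta> assume "\<theta> \<in> carrier (Mor (functor_category k C D) G H)"
      then have \<theta>: "\<theta> \<in> nat_trans C D G H" by simp
      show "Comp (functor_category k C D) F G H \<theta> \<eta> \<in> carrier (Mor (functor_category k C D) F H)"
        unfolding functor_category_simps by (rule nat_trans_Comp[OF assms F G H \<eta> \<theta>])
    qed (auto intro!: restrict_ext simp: obj nat_trans_closed nat_trans_closed[OF \<eta>]
        D.Comp_add_left D.Comp_smult_left)
  next
    fix F G \<eta>
    assume "F \<in> Obj (functor_category k C D)" "G \<in> Obj (functor_category k C D)"
      "\<eta> \<in> carrier (Mor (functor_category k C D) F G)"
    then have F: "linear_functor k C D F" and G: "linear_functor k C D G"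
      and \<eta>: "\<eta> \<in> nat_trans C D F G" by auto
    note [simp] = linear_functor_obj[OF F] linear_functor_obj[OF G] nat_trans_closed[OF \<eta>]
    show "Comp (functor_category k C D) F G G (Ident (functor_category k C D) G) \<eta> = \<eta>"
      "Comp (functor_category k C D) F F G \<eta> (Ident (functor_category k C D) F) = \<eta>"
      by (rule extensionalityI[OF _ nat_trans_extensional[OF \<eta>]];
          simp add: D.Comp_Ident_left D.Comp_Ident_right)+
  next
    fix F G H K \<eta> \<theta> \<kappa>
    assume "F \<in> Obj (functor_category k C D)" "G \<in> Obj (functor_category k C D)"
      "H \<in> Obj (functor_category k C D)" "K \<in> Obj (functor_category k C D)"
      "\<eta> \<in> carrier (Mor (functor_category k C D) F G)" "\<theta> \<in> carrier (Mor (functor_category k C D) G H)"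
      "\<kappa> \<in> carrier (Mor (functor_category k C D) H K)"
    then have F: "linear_functor k C D F" and G: "linear_functor k C D G"
      and H: "linear_functor k C D H" and K: "linear_functor k C D K" and \<eta>: "\<eta> \<in> nat_trans C D F G"
      and \<theta>: "\<theta> \<in> nat_trans C D G H" and \<kappa>: "\<kappa> \<in> nat_trans C D H K" by auto
    show "Comp (functor_category k C D) F H K \<kappa> (Comp (functor_category k C D) F G H \<theta> \<eta>)
        = Comp (functor_category k C D) F G K (Comp (functor_category k C D) G H K \<kappa> \<theta>) \<eta>"
      unfolding functor_category_simps
      by (rule restrict_ext)
        (simp add: linear_functor_obj[OF F] linear_functor_obj[OF G] linear_functor_obj[OF H]
          linear_functor_obj[OF K] nat_trans_closed[OF \<eta>] nat_trans_closed[OF \<theta>]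
          nat_trans_closed[OF \<kappa>] D.Comp_assoc)
  qed
qed

text \<open>The comparison with a corner is constructed as a map from the given
  \<open>D\<close>-module to the corner, whereas the criterion for equivalences asks for the
  opposite direction.\<close>

lemma is_iso_sym: "is_iso C x y f \<Longrightarrow> \<exists>g. is_iso C y x g"
  by (auto simp: is_iso_def)

text \<open>Pointwise inverses are natural of their own accord: insert the identity as
  \<open>\<eta> x\<close> after \<open>\<theta> x\<close>, use naturality of \<open>\<eta>\<close>,
  and cancel \<open>\<theta> y\<close> against \<open>\<eta> y\<close>.\<close>

lemma is_iso_functor_categoryI:
  assumes "k_category k D" "linear_functor k C D F" "linear_functor k C D G"
    and \<eta>: "\<eta> \<in> nat_trans C D F G"
    and iso: "\<And>x. x \<in> Obj C \<Longrightarrow> is_iso D (on_obj F x) (on_obj G x) (\<eta> x)"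
  shows "is_iso (functor_category k C D) F G \<eta>"
proof -
  interpret D: k_category k D by fact
  note obj = linear_functor_obj[OF assms(2)] linear_functor_obj[OF assms(3)]
  note cl = linear_functor_closed[OF assms(2)] linear_functor_closed[OF assms(3)]
  obtain \<theta> where \<theta>: "\<And>x. x \<in> Obj C \<Longrightarrow> \<theta> x \<in> carrier (Mor D (on_obj G x) (on_obj F x))"
    and l: "\<And>x. x \<in> Obj C
        \<Longrightarrow> Comp D (on_obj F x) (on_obj G x) (on_obj F x) (\<theta> x) (\<eta> x) = Ident D (on_obj F x)"
    and r: "\<And>x. x \<in> Obj C
        \<Longrightarrow> Comp D (on_obj G x) (on_obj F x) (on_obj G x) (\<eta> x) (\<theta> x) = Ident D (on_obj G x)"
    using bchoice[of "Obj C" "\<lambda>x g. g \<in> carrier (Mor D (on_obj G x) (on_obj F x))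
          \<and> Comp D (on_obj F x) (on_obj G x) (on_obj F x) g (\<eta> x) = Ident D (on_obj F x)
          \<and> Comp D (on_obj G x) (on_obj F x) (on_obj G x) (\<eta> x) g = Ident D (on_obj G x)"]
      iso unfolding is_iso_def by blast
  have "(\<lambda>x\<in>Obj C. \<theta> x) \<in> nat_trans C D G F"
  proof (rule restrict_nat_transI)
    fix x y f assume xy: "x \<in> Obj C" "y \<in> Obj C" and f: "f \<in> carrier (Mor C x y)"
    let ?Fx = "on_obj F x" and ?Fy = "on_obj F y" and ?Gx = "on_obj G x" and ?Gy = "on_obj G y"
    let ?Ff = "on_mor F x y f" and ?Gf = "on_mor G x y f"
    note [simp] = xy f obj cl \<theta> nat_trans_closed[OF \<eta>] D.Comp_closed
    have "Comp D ?Gx ?Gy ?Fy (\<theta> y) ?Gf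
        = Comp D ?Gx ?Gy ?Fy (\<theta> y) (Comp D ?Gx ?Gx ?Gy ?Gf (Comp D ?Gx ?Fx ?Gx (\<eta> x) (\<theta> x)))"
      by (simp add: r D.Comp_Ident_right)
    also have "\<dots> = Comp D ?Gx ?Gy ?Fy (\<theta> y) (Comp D ?Gx ?Fx ?Gy (Comp D ?Fx ?Gx ?Gy ?Gf (\<eta> x)) (\<theta> x))"
      by (simp add: D.Comp_assoc)
    also have "\<dots> = Comp D ?Gx ?Gy ?Fy (\<theta> y) (Comp D ?Gx ?Fx ?Gy (Comp D ?Fx ?Fy ?Gy (\<eta> y) ?Ff) (\<theta> x))"
      by (simp add: nat_trans_natural[OF \<eta>])
    also have "\<dots> = Comp D ?Gx ?Fx ?Fy (Comp D ?Fx ?Fy ?Fy (Comp D ?Fy ?Gy ?Fy (\<theta> y) (\<eta> y)) ?Ff) (\<theta> x)"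
      by (simp add: D.Comp_assoc)
    also have "\<dots> = Comp D ?Gx ?Fx ?Fy ?Ff (\<theta> x)"
      by (simp add: l D.Comp_Ident_left)
    finally show "Comp D ?Gx ?Gy ?Fy (\<theta> y) ?Gf = Comp D ?Gx ?Fx ?Fy ?Ff (\<theta> x)" .
  qed (rule \<theta>)
  then show ?thesis
    unfolding is_iso_def
    using \<eta> by (auto intro!: bexI[of _ "\<lambda>x\<in>Obj C. \<theta> x"] restrict_ext simp: l r)
qed

text \<open>The set-theoretic inverse is linear because the required equations hold after applying
  the injective linear map \<open>f\<close>.\<close>

lemma is_iso_vectI:
  assumes "module k V" "module k W" and f: "linear_map k V W f" "f \<in> extensional (carrier V)"
    and bij: "bij_betw f (carrier V) (carrier W)"
  shows "is_iso (vect k) V W f"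
proof -
  interpret V: module k V by fact
  interpret W: module k W by fact
  define g where "g = inv_into (carrier V) f"
  have g: "g w \<in> carrier V" "f (g w) = w" if "w \<in> carrier W" for w
    using bij that by (auto simp: g_def bij_betw_def inv_into_into f_inv_into_f)
  have gf: "g (f v) = v" if "v \<in> carrier V" for v
    using bij that by (auto simp: g_def bij_betw_def)
  have inj: "u = v" if "f u = f v" "u \<in> carrier V" "v \<in> carrier V" for u v
    using gf that by metis
  have "linear_map k W V g"
    by (rule linear_mapI; (rule inj)?) (auto simp: g linear_map_add[OF f(1)] linear_map_smult[OF f(1)])
  then have "(\<lambda>w\<in>carrier W. g w) \<in> carrier (Mor (vect k) W V)"
    using assms(2) by (simp add: linear_map_restrict)
  then show ?thesis
    unfolding is_iso_def using f
    by (auto intro!: bexI[of _ "\<lambda>w\<in>carrier W. g w"] restrict_ext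
        simp: compose_def g gf linear_map_closed)
qed

section \<open>Fully faithful and essentially surjective functors\<close>

text \<open>Choose for each \<open>b\<close> an object \<open>F b\<close> with an isomorphism
  \<open>\<epsilon> b\<close> from \<open>G (F b)\<close> to \<open>b\<close>, conjugate morphisms
  of \<open>B\<close> by these isomorphisms, and pull the results back along the bijections that
  \<open>G\<close> induces on morphisms. Each identity needed in \<open>A\<close> is verified after
  applying \<open>G\<close>, which is injective on morphisms.\<close>

lemma k_equivalent_if_fully_faithful_essentially_surjective:
  assumes "k_category k A" "k_category k B" and G: "linear_functor k A B G"
    and ff: "\<And>x y. \<lbrakk>x \<in> Obj A; y \<in> Obj A\<rbrakk> \<Longrightarrow>
      bij_betw (on_mor G x y) (carrier (Mor A x y)) (carrier (Mor B (on_obj G x) (on_obj G y)))"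
    and es: "\<And>b. b \<in> Obj B \<Longrightarrow> \<exists>a\<in>Obj A. \<exists>f. is_iso B (on_obj G a) b f"
  shows "k_equivalent k B A"
proof -
  interpret A: k_category k A by fact
  interpret B: k_category k B by fact
  let ?G = "on_obj G"
  obtain F \<epsilon> \<delta> where F: "\<And>b. b \<in> Obj B \<Longrightarrow> F b \<in> Obj A"
    and \<epsilon>: "\<And>b. b \<in> Obj B \<Longrightarrow> \<epsilon> b \<in> carrier (Mor B (?G (F b)) b)"
    and \<delta>: "\<And>b. b \<in> Obj B \<Longrightarrow> \<delta> b \<in> carrier (Mor B b (?G (F b)))"
    and \<delta>\<epsilon>: "\<And>b. b \<in> Obj B \<Longrightarrow> Comp B (?G (F b)) b (?G (F b)) (\<delta> b) (\<epsilon> b) = Ident B (?G (F b))"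
    and \<epsilon>\<delta>: "\<And>b. b \<in> Obj B \<Longrightarrow> Comp B b (?G (F b)) b (\<epsilon> b) (\<delta> b) = Ident B b"
    using es unfolding is_iso_def by metis
  note [simp] = linear_functor_obj[OF G] linear_functor_closed[OF G] F \<epsilon> \<delta> A.Comp_closed B.Comp_closed
    A.Ident_closed B.Ident_closed B.Comp_Ident_left B.Comp_Ident_right
  define lift where "lift x y = inv_into (carrier (Mor A x y)) (on_mor G x y)" for x y
  have lift [simp]: "lift x y h \<in> carrier (Mor A x y)" "on_mor G x y (lift x y h) = h"
    if "x \<in> Obj A" "y \<in> Obj A" "h \<in> carrier (Mor B (?G x) (?G y))" for x y h
    using ff[OF that(1,2)] that(3)
    by (auto simp: lift_def bij_betw_def inv_into_into f_inv_into_f)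
  have faithful: "f = g"
    if "on_mor G x y f = on_mor G x y g" "x \<in> Obj A" "y \<in> Obj A"
      "f \<in> carrier (Mor A x y)" "g \<in> carrier (Mor A x y)" for x y f g
    using ff[OF that(2,3)] that(1,4,5) by (auto simp: bij_betw_def inj_on_def)
  \<comment> \<open>Conjugation by the chosen isomorphisms turns \<open>f\<close> into a morphism
    between objects in the image of \<open>G\<close>, where fullness applies.\<close>
  define conj where "conj b c f = Comp B (?G (F b)) c (?G (F c)) (\<delta> c) (Comp B (?G (F b)) b c f (\<epsilon> b))"
    for b c f
  have conj_linear: "linear_map k (Mor B b c) (Mor B (?G (F b)) (?G (F c))) (conj b c)"
    if "b \<in> Obj B" "c \<in> Obj B" for b c
    unfolding conj_def using that
    by (intro linear_map_comp[OF B.Comp_linear_left B.Comp_linear_right]) auto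
  have conj [simp]: "conj b c f \<in> carrier (Mor B (?G (F b)) (?G (F c)))"
    if "b \<in> Obj B" "c \<in> Obj B" "f \<in> carrier (Mor B b c)" for b c f
    using that linear_map_closed[OF conj_linear] by blast
  have conj_Comp: "conj b d (Comp B b c d g f)
      = Comp B (?G (F b)) (?G (F c)) (?G (F d)) (conj c d g) (conj b c f)"
    if [simp]: "b \<in> Obj B" "c \<in> Obj B" "d \<in> Obj B" "f \<in> carrier (Mor B b c)" "g \<in> carrier (Mor B c d)"
    for b c d f g
  proof -
    let ?b = "?G (F b)" and ?c = "?G (F c)" and ?d = "?G (F d)"
    \<comment> \<open>Between the two conjugates \<open>\<epsilon> c\<close> meets
      \<open>\<delta> c\<close>; reassociating isolates this composite, which is the identity of
      \<open>c\<close>.\<close>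
    have "Comp B ?b ?c ?d (conj c d g) (conj b c f)
        = Comp B ?b d ?d (\<delta> d) (Comp B ?b c d g (Comp B ?b c c (Comp B c ?c c (\<epsilon> c) (\<delta> c)) (Comp B ?b b c f (\<epsilon> b))))"
      by (simp add: conj_def B.Comp_assoc del: B.Comp_Ident_left)
    also have "\<dots> = conj b d (Comp B b c d g f)"
      by (simp add: \<epsilon>\<delta> conj_def B.Comp_assoc)
    finally show ?thesis by simp
  qed
  have \<epsilon>_conj: "Comp B (?G (F b)) (?G (F c)) c (\<epsilon> c) (conj b c f) = Comp B (?G (F b)) b c f (\<epsilon> b)"
    if [simp]: "b \<in> Obj B" "c \<in> Obj B" "f \<in> carrier (Mor B b c)" for b c f
  proof -
    let ?b = "?G (F b)" and ?c = "?G (F c)"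
    have "Comp B ?b ?c c (\<epsilon> c) (conj b c f) = Comp B ?b c c (Comp B c ?c c (\<epsilon> c) (\<delta> c)) (Comp B ?b b c f (\<epsilon> b))"
      unfolding conj_def by (rule B.Comp_assoc) auto
    then show ?thesis by (simp add: \<epsilon>\<delta>)
  qed
  \<comment> \<open>On morphisms this is forced by the equation \<open>G (H f) = conj f\<close>, as
    \<open>G\<close> is faithful.\<close>
  define H where "H = \<lparr>on_obj = F, on_mor = (\<lambda>b c f. lift (F b) (F c) (conj b c f))\<rparr>"
  have H_simps [simp]: "on_obj H = F" "on_mor H b c f = lift (F b) (F c) (conj b c f)" for b c f
    by (simp_all add: H_def)
  have H: "linear_functor k B A H"
  proof (rule linear_functorI)
    show "on_obj H b \<in> Obj A" if "b \<in> Obj B" for b using that by simp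
  next
    fix b c assume [simp]: "b \<in> Obj B" "c \<in> Obj B"
    note conj_lin = conj_linear[OF \<open>b \<in> Obj B\<close> \<open>c \<in> Obj B\<close>]
    note G_lin = linear_functor_linear[OF G F[OF \<open>b \<in> Obj B\<close>] F[OF \<open>c \<in> Obj B\<close>]]
    have BM: "module k (Mor B b c)" and AM: "module k (Mor A (F b) (F c))"
      by (simp_all add: B.Mor_module A.Mor_module)
    interpret BM: module k "Mor B b c" by fact
    interpret AM: module k "Mor A (F b) (F c)" by fact
    interpret GM: module k "Mor B (?G (F b)) (?G (F c))" by (simp add: B.Mor_module)
    show "linear_map k (Mor B b c) (Mor A (on_obj H b) (on_obj H c)) (on_mor H b c)"
      unfolding H_simps
      by (rule linear_mapI; (rule faithful)?)
        (auto simp: linear_map_add[OF conj_lin] linear_map_smult[OF conj_lin]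
          linear_map_add[OF G_lin] linear_map_smult[OF G_lin])
  next
    fix b assume [simp]: "b \<in> Obj B"
    show "on_mor H b b (Ident B b) = Ident A (on_obj H b)"
      by (rule faithful[of "F b" "F b"]) (auto simp: linear_functor_Ident[OF G] conj_def \<delta>\<epsilon>)
  next
    fix b c d f g
    assume [simp]: "b \<in> Obj B" "c \<in> Obj B" "d \<in> Obj B" "f \<in> carrier (Mor B b c)" "g \<in> carrier (Mor B c d)"
    show "on_mor H b d (Comp B b c d g f)
        = Comp A (on_obj H b) (on_obj H c) (on_obj H d) (on_mor H c d g) (on_mor H b c f)"
      by (rule faithful[of "F b" "F d"]) (auto simp: linear_functor_Comp[OF G] conj_Comp)
  qed
  have "naturally_isomorphic B B (comp_functor G H) id_functor"
    unfolding naturally_isomorphic_def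
  proof (intro bexI ballI)
    show "(\<lambda>b\<in>Obj B. \<epsilon> b) \<in> nat_trans B B (comp_functor G H) id_functor"
      by (rule restrict_nat_transI) (simp_all add: comp_functor_def id_functor_def \<epsilon>_conj)
    show "is_iso B (on_obj (comp_functor G H) b) (on_obj id_functor b) ((\<lambda>b\<in>Obj B. \<epsilon> b) b)"
      if "b \<in> Obj B" for b
      using that by (auto simp: is_iso_def comp_functor_def id_functor_def intro!: bexI[of _ "\<delta> b"] \<delta>\<epsilon> \<epsilon>\<delta>)
  qed
  moreover have "naturally_isomorphic A A (comp_functor H G) id_functor"
    unfolding naturally_isomorphic_def
  proof (intro bexI ballI)
    \<comment> \<open>At an object \<open>G a\<close> the isomorphism \<open>\<epsilon>\<close> has
      source and target in the image of \<open>G\<close>, so it lifts to a morphism from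
      \<open>F (G a)\<close> to \<open>a\<close>; lifting \<open>\<delta>\<close> in the same way
      gives the inverse.\<close>
    show "(\<lambda>a\<in>Obj A. lift (F (?G a)) a (\<epsilon> (?G a))) \<in> nat_trans A A (comp_functor H G) id_functor"
    proof (rule restrict_nat_transI)
      fix a a' f assume [simp]: "a \<in> Obj A" "a' \<in> Obj A" "f \<in> carrier (Mor A a a')"
      show "Comp A (on_obj (comp_functor H G) a) (on_obj (comp_functor H G) a') (on_obj id_functor a')
          (lift (F (?G a')) a' (\<epsilon> (?G a'))) (on_mor (comp_functor H G) a a' f)
        = Comp A (on_obj (comp_functor H G) a) (on_obj id_functor a) (on_obj id_functor a')
          (on_mor id_functor a a' f) (lift (F (?G a)) a (\<epsilon> (?G a)))"
        by (rule faithful[of "F (?G a)" a'])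
          (simp_all add: comp_functor_def id_functor_def linear_functor_Comp[OF G] \<epsilon>_conj)
    qed (simp add: comp_functor_def id_functor_def)
    show "is_iso A (on_obj (comp_functor H G) a) (on_obj id_functor a)
        ((\<lambda>a\<in>Obj A. lift (F (?G a)) a (\<epsilon> (?G a))) a)" if [simp]: "a \<in> Obj A" for a
    proof -
      have "Comp A (F (?G a)) a (F (?G a)) (lift a (F (?G a)) (\<delta> (?G a))) (lift (F (?G a)) a (\<epsilon> (?G a)))
          = Ident A (F (?G a))"
        by (rule faithful[of "F (?G a)" "F (?G a)"])
          (simp_all add: linear_functor_Comp[OF G] linear_functor_Ident[OF G] \<delta>\<epsilon>)
      moreover have "Comp A a (F (?G a)) a (lift (F (?G a)) a (\<epsilon> (?G a))) (lift a (F (?G a)) (\<delta> (?G a)))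
          = Ident A a"
        by (rule faithful[of a a])
          (simp_all add: linear_functor_Comp[OF G] linear_functor_Ident[OF G] \<epsilon>\<delta>)
      ultimately show ?thesis
        by (auto simp: is_iso_def comp_functor_def id_functor_def
            intro!: bexI[of _ "lift a (F (?G a)) (\<delta> (?G a))"])
    qed
  qed
  ultimately show ?thesis
    unfolding k_equivalent_def using assms(1,2) G H by blast
qed

section \<open>The contracted category\<close>

locale contraction = k_category k D
  for k :: "('k, 'r) ring_scheme" (structure) and D :: "('k, 'o, 'm) kcat" +
  fixes I :: "'i set" and E :: "'i \<Rightarrow> 'o set"
  assumes partition: "indexed_partition (Obj D) I E"
    and finite_block: "i \<in> I \<Longrightarrow> finite (E i)"
begin

abbreviation DE :: "('k, 'i, 'o \<times> 'o \<Rightarrow> 'm) kcat" where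
  "DE \<equiv> contracted_category D I E"

text \<open>The partition read as a function on objects. With the index recovered from the object,
  single-entry matrices and corners can be indexed by objects of \<open>D\<close> alone.\<close>

definition block :: "'o \<Rightarrow> 'i" where
  "block x = (THE i. i \<in> I \<and> x \<in> E i)"

lemma block_eq: "\<lbrakk>i \<in> I; x \<in> E i\<rbrakk> \<Longrightarrow> block x = i"
  using partition unfolding block_def indexed_partition_def disjoint_family_on_def by blast

lemma Obj_block [simp]: "\<lbrakk>i \<in> I; x \<in> E i\<rbrakk> \<Longrightarrow> x \<in> Obj D"
  using partition by (auto simp: indexed_partition_def)

lemma
  assumes "x \<in> Obj D"
  shows block_in [simp]: "block x \<in> I" and in_block [simp]: "x \<in> E (block x)"
proof -
  obtain i where "i \<in> I" "x \<in> E i"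
    using assms partition by (auto simp: indexed_partition_def)
  then show "block x \<in> I" "x \<in> E (block x)" by (simp_all add: block_eq)
qed

lemma Mor_zero_closed [simp]: "\<lbrakk>x \<in> Obj D; y \<in> Obj D\<rbrakk> \<Longrightarrow> \<zero>\<^bsub>Mor D x y\<^esub> \<in> carrier (Mor D x y)"
  by (intro abelian_monoid.zero_closed Mor_abelian_monoid)

lemma contracted_Obj [simp]: "Obj DE = I"
  by (simp add: contracted_category_def)

text \<open>Since blocks are finite, the finite-support condition in the direct sum is void, and
  membership becomes a condition on each entry.\<close>

lemma contracted_Mor:
  assumes "i \<in> I" "j \<in> I"
  shows "Mor DE i j = pointwise_module (E j \<times> E i) (\<lambda>(y, x). Mor D x y)
    (\<Pi>\<^sub>E p\<in>E j \<times> E i. carrier (case p of (y, x) \<Rightarrow> Mor D x y))"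
  using assms by (simp add: contracted_category_def direct_sum_finite finite_block)

lemma contracted_Mor_module: "\<lbrakk>i \<in> I; j \<in> I\<rbrakk> \<Longrightarrow> module k (Mor DE i j)"
  unfolding contracted_category_def kcat.simps
  by (rule module_direct_sum_finite) (auto simp: finite_block is_cring intro!: Mor_module)

lemma contracted_carrier_iff:
  assumes "i \<in> I" "j \<in> I"
  shows "m \<in> carrier (Mor DE i j)
    \<longleftrightarrow> m \<in> extensional (E j \<times> E i) \<and> (\<forall>y\<in>E j. \<forall>x\<in>E i. m (y, x) \<in> carrier (Mor D x y))"
  using assms by (auto simp: contracted_Mor PiE_iff)

lemma contracted_entry_closed:
  "\<lbrakk>m \<in> carrier (Mor DE i j); i \<in> I; j \<in> I; y \<in> E j; x \<in> E i\<rbrakk> \<Longrightarrow> m (y, x) \<in> carrier (Mor D x y)"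
  by (simp add: contracted_carrier_iff)

lemma contracted_eqI:
  assumes "m \<in> carrier (Mor DE i j)" "n \<in> carrier (Mor DE i j)" "i \<in> I" "j \<in> I"
    and "\<And>y x. \<lbrakk>y \<in> E j; x \<in> E i\<rbrakk> \<Longrightarrow> m (y, x) = n (y, x)"
  shows "m = n"
  using assms by (auto simp: contracted_carrier_iff intro!: extensionalityI[of m "E j \<times> E i" n])

lemma contracted_zero_entry:
  "\<lbrakk>i \<in> I; j \<in> I; y \<in> E j; x \<in> E i\<rbrakk> \<Longrightarrow> \<zero>\<^bsub>Mor DE i j\<^esub> (y, x) = \<zero>\<^bsub>Mor D x y\<^esub>"
  by (simp add: contracted_Mor)

lemma linear_map_contracted_entry:
  assumes "i \<in> I" "j \<in> I" "y \<in> E j" "x \<in> E i"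
  shows "linear_map k (Mor DE i j) (Mor D x y) (\<lambda>m. m (y, x))"
  using linear_map_direct_sum_entry[of "E j \<times> E i" "(y, x)" k "\<lambda>(y, x). Mor D x y"] assms
  by (simp add: contracted_category_def finite_block)

lemma linear_map_contractedI:
  assumes "i \<in> I" "j \<in> I" "module k V" "\<And>v. v \<in> carrier V \<Longrightarrow> f v \<in> carrier (Mor DE i j)"
    and "\<And>y x. \<lbrakk>y \<in> E j; x \<in> E i\<rbrakk> \<Longrightarrow> linear_map k V (Mor D x y) (\<lambda>v. f v (y, x))"
  shows "linear_map k V (Mor DE i j) f"
  unfolding contracted_category_def kcat.simps
  using assms by (intro linear_map_direct_sumI) (auto simp: finite_block contracted_carrier_iff)

lemma contracted_finsum_entry:
  assumes "i \<in> I" "j \<in> I" "y \<in> E j" "x \<in> E i" "h \<in> A \<rightarrow> carrier (Mor DE i j)"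
  shows "finsum (Mor DE i j) h A (y, x) = finsum (Mor D x y) (\<lambda>a. h a (y, x)) A"
  using assms by (intro linear_map_finsum[OF _ _ linear_map_contracted_entry])
    (auto intro!: contracted_Mor_module Mor_module)

lemma contracted_Comp_entry:
  "\<lbrakk>z \<in> E l; x \<in> E i\<rbrakk> \<Longrightarrow> Comp DE i j l n m (z, x)
    = finsum (Mor D x z) (\<lambda>y. Comp D x y z (n (z, y)) (m (y, x))) (E j)"
  by (simp add: contracted_category_def)

lemma contracted_Ident_entry:
  "\<lbrakk>y \<in> E i; x \<in> E i\<rbrakk> \<Longrightarrow> Ident DE i (y, x) = (if y = x then Ident D x else \<zero>\<^bsub>Mor D x y\<^esub>)"
  by (simp add: contracted_category_def)

lemma contracted_Ident_closed: "i \<in> I \<Longrightarrow> Ident DE i \<in> carrier (Mor DE i i)"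
  unfolding contracted_carrier_iff
  by (auto simp: contracted_Ident_entry Ident_closed) (simp add: contracted_category_def)

lemma contracted_Comp_closed:
  assumes "i \<in> I" "j \<in> I" "l \<in> I" "m \<in> carrier (Mor DE i j)" "n \<in> carrier (Mor DE j l)"
  shows "Comp DE i j l n m \<in> carrier (Mor DE i l)"
proof -
  have "Comp DE i j l n m \<in> extensional (E l \<times> E i)"
    by (simp add: contracted_category_def)
  moreover have "Comp DE i j l n m (z, x) \<in> carrier (Mor D x z)" if "z \<in> E l" "x \<in> E i" for z x
    using assms that
    by (auto simp: contracted_Comp_entry contracted_entry_closed
        intro!: abelian_monoid.finsum_closed Mor_abelian_monoid Comp_closed)
  ultimately show ?thesis
    using assms by (simp add: contracted_carrier_iff)
qed

text \<open>For the unit laws, the identity matrix vanishes off the diagonal, so one summand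
  survives. For associativity, linearity of composition in \<open>D\<close> moves it inside the
  inner sum, the two sums are exchanged, and associativity of \<open>D\<close> applies to each
  term.\<close>

lemma k_category_contracted: "k_category k DE"
proof (intro k_category.intro k_category_axioms.intro field_axioms, unfold contracted_Obj)
  fix i j l n
  assume [simp]: "i \<in> I" "j \<in> I" "l \<in> I" and n: "n \<in> carrier (Mor DE j l)"
  show "linear_map k (Mor DE i j) (Mor DE i l) (Comp DE i j l n)"
  proof (rule linear_map_contractedI)
    fix z x assume zx: "z \<in> E l" "x \<in> E i"
    then have [simp]: "z \<in> Obj D" "x \<in> Obj D" by (auto intro: Obj_block[of l] Obj_block[of i])
    have "linear_map k (Mor DE i j) (Mor D x z) (\<lambda>m. Comp D x y z (n (z, y)) (m (y, x)))"
      if "y \<in> E j" for y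
      using that zx n Obj_block[of j y]
      by (intro linear_map_comp[OF linear_map_contracted_entry Comp_linear_right])
        (auto simp: contracted_entry_closed)
    then show "linear_map k (Mor DE i j) (Mor D x z) (\<lambda>m. Comp DE i j l n m (z, x))"
      using zx by (simp add: contracted_Comp_entry linear_map_finsum_pointwise contracted_Mor_module Mor_module)
  qed (use n in \<open>auto intro: contracted_Mor_module contracted_Comp_closed\<close>)
next
  fix i j l m
  assume [simp]: "i \<in> I" "j \<in> I" "l \<in> I" and m: "m \<in> carrier (Mor DE i j)"
  show "linear_map k (Mor DE j l) (Mor DE i l) (\<lambda>n. Comp DE i j l n m)"
  proof (rule linear_map_contractedI)
    fix z x assume zx: "z \<in> E l" "x \<in> E i"
    then have [simp]: "z \<in> Obj D" "x \<in> Obj D" by (auto intro: Obj_block[of l] Obj_block[of i])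
    have "linear_map k (Mor DE j l) (Mor D x z) (\<lambda>n. Comp D x y z (n (z, y)) (m (y, x)))"
      if "y \<in> E j" for y
      using that zx m Obj_block[of j y]
      by (intro linear_map_comp[OF linear_map_contracted_entry Comp_linear_left])
        (auto simp: contracted_entry_closed)
    then show "linear_map k (Mor DE j l) (Mor D x z) (\<lambda>n. Comp DE i j l n m (z, x))"
      using zx by (simp add: contracted_Comp_entry linear_map_finsum_pointwise contracted_Mor_module Mor_module)
  qed (use m in \<open>auto intro: contracted_Mor_module contracted_Comp_closed\<close>)
next
  fix i j m
  assume [simp]: "i \<in> I" "j \<in> I" and m: "m \<in> carrier (Mor DE i j)"
  note [simp] = contracted_entry_closed[OF m]
  show "Comp DE i j j (Ident DE j) m = m"
  proof (rule contracted_eqI)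
    fix y x assume yx [simp]: "y \<in> E j" "x \<in> E i"
    then have [simp]: "y \<in> Obj D" "x \<in> Obj D" by (auto intro: Obj_block[of j] Obj_block[of i])
    have "finsum (Mor D x y) (\<lambda>y'. Comp D x y' y (Ident DE j (y, y')) (m (y', x))) (E j)
        = Comp D x y y (Ident DE j (y, y)) (m (y, x))"
      using Obj_block[of j]
      by (intro abelian_monoid.finsum_eq_single Mor_abelian_monoid)
        (auto simp: finite_block contracted_Ident_entry Comp_zero_left Comp_closed Ident_closed)
    then show "Comp DE i j j (Ident DE j) m (y, x) = m (y, x)"
      by (simp add: contracted_Comp_entry contracted_Ident_entry Comp_Ident_left)
  qed (simp_all add: m contracted_Comp_closed contracted_Ident_closed)
  show "Comp DE i i j m (Ident DE i) = m"
  proof (rule contracted_eqI)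
    fix y x assume yx [simp]: "y \<in> E j" "x \<in> E i"
    then have [simp]: "y \<in> Obj D" "x \<in> Obj D" by (auto intro: Obj_block[of j] Obj_block[of i])
    have "finsum (Mor D x y) (\<lambda>x'. Comp D x x' y (m (y, x')) (Ident DE i (x', x))) (E i)
        = Comp D x x y (m (y, x)) (Ident DE i (x, x))"
      using Obj_block[of i]
      by (intro abelian_monoid.finsum_eq_single Mor_abelian_monoid)
        (auto simp: finite_block contracted_Ident_entry Comp_zero_right Comp_closed Ident_closed)
    then show "Comp DE i i j m (Ident DE i) (y, x) = m (y, x)"
      by (simp add: contracted_Comp_entry contracted_Ident_entry Comp_Ident_right)
  qed (simp_all add: m contracted_Comp_closed contracted_Ident_closed)
next
  fix h i j l p m n
  assume I [simp]: "h \<in> I" "i \<in> I" "j \<in> I" "l \<in> I"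
    and p: "p \<in> carrier (Mor DE h i)" and m: "m \<in> carrier (Mor DE i j)" and n: "n \<in> carrier (Mor DE j l)"
  note [simp] = contracted_entry_closed[OF p] contracted_entry_closed[OF m] contracted_entry_closed[OF n]
  show "Comp DE h j l n (Comp DE h i j m p) = Comp DE h i l (Comp DE i j l n m) p"
  proof (rule contracted_eqI)
    fix z w assume zw [simp]: "z \<in> E l" "w \<in> E h"
    have obj [simp]: "z \<in> Obj D" "w \<in> Obj D" "\<And>x. x \<in> E i \<Longrightarrow> x \<in> Obj D" "\<And>y. y \<in> E j \<Longrightarrow> y \<in> Obj D"
      using zw I Obj_block by blast+
    interpret wz: module k "Mor D w z" by (rule Mor_module) simp_all
    have "Comp DE h j l n (Comp DE h i j m p) (z, w)
        = finsum (Mor D w z) (\<lambda>y. finsum (Mor D w z)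
            (\<lambda>x. Comp D w y z (n (z, y)) (Comp D w x y (m (y, x)) (p (x, w)))) (E i)) (E j)"
      unfolding contracted_Comp_entry[OF zw]
      by (intro wz.finsum_cong')
        (auto simp: contracted_Comp_entry Comp_closed intro!: Comp_finsum_right)
    also have "\<dots> = finsum (Mor D w z) (\<lambda>x. finsum (Mor D w z)
            (\<lambda>y. Comp D w y z (n (z, y)) (Comp D w x y (m (y, x)) (p (x, w)))) (E j)) (E i)"
      by (rule wz.finsum_swap) (auto simp: finite_block Comp_closed)
    also have "\<dots> = finsum (Mor D w z) (\<lambda>x. finsum (Mor D w z)
            (\<lambda>y. Comp D w x z (Comp D x y z (n (z, y)) (m (y, x))) (p (x, w))) (E j)) (E i)"
      by (intro wz.finsum_cong') (auto simp: Comp_assoc Comp_closed)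
    also have "\<dots> = Comp DE h i l (Comp DE i j l n m) p (z, w)"
      unfolding contracted_Comp_entry[OF zw]
      by (intro wz.finsum_cong' Comp_finsum_left[symmetric])
        (auto simp: contracted_Comp_entry Comp_closed Comp_finsum_left[symmetric]
          intro!: abelian_monoid.finsum_closed Mor_abelian_monoid Comp_closed)
    finally show "Comp DE h j l n (Comp DE h i j m p) (z, w)
        = Comp DE h i l (Comp DE i j l n m) p (z, w)" .
  qed (simp_all add: p m n contracted_Comp_closed)
qed (auto intro: contracted_Mor_module contracted_Ident_closed)


section \<open>Single-entry matrices and the idempotents they contain\<close>

text \<open>A multiple of a matrix unit. As for matrix entries, the row \<open>y\<close>, which is
  the target of \<open>f\<close>, comes before the column \<open>x\<close>, its source; the shape of
  the matrix is read off from \<open>block\<close>.\<close>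

definition elementary :: "'o \<Rightarrow> 'o \<Rightarrow> 'm \<Rightarrow> 'o \<times> 'o \<Rightarrow> 'm" where
  "elementary y x f =
    (\<lambda>(b, a)\<in>E (block y) \<times> E (block x). if b = y \<and> a = x then f else \<zero>\<^bsub>Mor D a b\<^esub>)"

lemma elementary_entry:
  "\<lbrakk>b \<in> E (block y); a \<in> E (block x)\<rbrakk>
    \<Longrightarrow> elementary y x f (b, a) = (if b = y \<and> a = x then f else \<zero>\<^bsub>Mor D a b\<^esub>)"
  by (simp add: elementary_def)

lemma elementary_closed:
  assumes "x \<in> Obj D" "y \<in> Obj D" "f \<in> carrier (Mor D x y)"
  shows "elementary y x f \<in> carrier (Mor DE (block x) (block y))"
proof -
  have "elementary y x f \<in> extensional (E (block y) \<times> E (block x))"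
    by (simp add: elementary_def)
  moreover have "elementary y x f (b, a) \<in> carrier (Mor D a b)"
    if "b \<in> E (block y)" "a \<in> E (block x)" for a b
    using assms that Obj_block[of "block x" a] Obj_block[of "block y" b] by (simp add: elementary_entry)
  ultimately show ?thesis
    using assms by (simp add: contracted_carrier_iff)
qed

lemma elementary_linear:
  assumes "x \<in> Obj D" "y \<in> Obj D"
  shows "linear_map k (Mor D x y) (Mor DE (block x) (block y)) (elementary y x)"
proof (rule linear_map_contractedI)
  fix b a assume ba: "b \<in> E (block y)" "a \<in> E (block x)"
  then interpret ab: module k "Mor D a b"
    using assms by (intro Mor_module) (auto intro: Obj_block[of "block x"] Obj_block[of "block y"])
  show "linear_map k (Mor D x y) (Mor D a b) (\<lambda>f. elementary y x f (b, a))"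
    using ba by (intro linear_mapI) (auto simp: elementary_entry)
qed (use assms in \<open>auto simp: elementary_closed intro: Mor_module\<close>)

text \<open>In the sum over the middle block only row \<open>y\<close> of the right factor can
  contribute, and that row vanishes outside column \<open>x\<close>.\<close>

lemma Comp_elementary_right_entry:
  assumes [simp]: "x \<in> Obj D" "y \<in> Obj D" "l \<in> I" and n: "n \<in> carrier (Mor DE (block y) l)"
    and f: "f \<in> carrier (Mor D x y)" and ba: "b \<in> E l" "a \<in> E (block x)"
  shows "Comp DE (block x) (block y) l n (elementary y x f) (b, a)
    = (if a = x then Comp D x y b (n (b, y)) f else \<zero>\<^bsub>Mor D a b\<^esub>)"
proof -
  have [simp]: "b \<in> Obj D" "a \<in> Obj D" using ba by (auto intro: Obj_block[of l] Obj_block[of "block x"])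
  have "finsum (Mor D a b) (\<lambda>c. Comp D a c b (n (b, c)) (elementary y x f (c, a))) (E (block y))
    = Comp D a y b (n (b, y)) (elementary y x f (y, a))"
    using ba n f Obj_block[of "block y"]
    by (intro abelian_monoid.finsum_eq_single Mor_abelian_monoid)
      (auto simp: finite_block elementary_entry Comp_zero_right contracted_entry_closed intro!: Comp_closed)
  then show ?thesis
    using ba n by (simp add: contracted_Comp_entry elementary_entry Comp_zero_right contracted_entry_closed)
qed

lemma Comp_elementary_left_entry:
  assumes [simp]: "i \<in> I" "y \<in> Obj D" "z \<in> Obj D" and m: "m \<in> carrier (Mor DE i (block y))"
    and g: "g \<in> carrier (Mor D y z)" and ba: "b \<in> E (block z)" "a \<in> E i"
  shows "Comp DE i (block y) (block z) (elementary z y g) m (b, a)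
    = (if b = z then Comp D a y z g (m (y, a)) else \<zero>\<^bsub>Mor D a b\<^esub>)"
proof -
  have [simp]: "b \<in> Obj D" "a \<in> Obj D" using ba by (auto intro: Obj_block[of i] Obj_block[of "block z"])
  have "finsum (Mor D a b) (\<lambda>c. Comp D a c b (elementary z y g (b, c)) (m (c, a))) (E (block y))
    = Comp D a y b (elementary z y g (b, y)) (m (y, a))"
    using ba m g Obj_block[of "block y"]
    by (intro abelian_monoid.finsum_eq_single Mor_abelian_monoid)
      (auto simp: finite_block elementary_entry Comp_zero_left contracted_entry_closed intro!: Comp_closed)
  then show ?thesis
    using ba m by (simp add: contracted_Comp_entry elementary_entry Comp_zero_left contracted_entry_closed)
qed

text \<open>Matrix units multiply as expected, so morphisms of \<open>D\<close> embed
  multiplicatively into matrices. Identities are not preserved: that of \<open>x\<close> becomes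
  \<open>idem x\<close>, which this lemma shows to be idempotent.\<close>

lemma elementary_Comp:
  assumes [simp]: "x \<in> Obj D" "y \<in> Obj D" "z \<in> Obj D"
    and f: "f \<in> carrier (Mor D x y)" and g: "g \<in> carrier (Mor D y z)"
  shows "Comp DE (block x) (block y) (block z) (elementary z y g) (elementary y x f)
    = elementary z x (Comp D x y z g f)"
proof (rule contracted_eqI)
  fix b a assume "b \<in> E (block z)" "a \<in> E (block x)"
  then show "Comp DE (block x) (block y) (block z) (elementary z y g) (elementary y x f) (b, a)
    = elementary z x (Comp D x y z g f) (b, a)"
    using f g Obj_block[of "block z" b]
    by (simp add: Comp_elementary_right_entry elementary_closed elementary_entry Comp_zero_left)
qed (use f g in \<open>auto simp: elementary_closed Comp_closed contracted_Comp_closed\<close>)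

text \<open>The column index of the left factor differs from the row index of the right one, so
  every term of the product contains a zero. Applied to identities, this is the orthogonality of the
  idempotents of one block.\<close>

lemma elementary_Comp_zero:
  assumes [simp]: "x \<in> Obj D" "y \<in> Obj D" "y' \<in> Obj D" "z \<in> Obj D"
    and y: "block y' = block y" "y' \<noteq> y"
    and f: "f \<in> carrier (Mor D x y)" and g: "g \<in> carrier (Mor D y' z)"
  shows "Comp DE (block x) (block y) (block z) (elementary z y' g) (elementary y x f)
    = \<zero>\<^bsub>Mor DE (block x) (block z)\<^esub>"
proof (rule contracted_eqI)
  interpret xz: module k "Mor DE (block x) (block z)" by (rule contracted_Mor_module) simp_all
  have g': "elementary z y' g \<in> carrier (Mor DE (block y) (block z))"
    using elementary_closed[of y' z g] g y(1) by simp
  show "Comp DE (block x) (block y) (block z) (elementary z y' g) (elementary y x f)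
      \<in> carrier (Mor DE (block x) (block z))"
    using g' f by (simp add: elementary_closed contracted_Comp_closed)
  show "\<zero>\<^bsub>Mor DE (block x) (block z)\<^esub> \<in> carrier (Mor DE (block x) (block z))" by simp
  fix b a assume "b \<in> E (block z)" "a \<in> E (block x)"
  then show "Comp DE (block x) (block y) (block z) (elementary z y' g) (elementary y x f) (b, a)
    = \<zero>\<^bsub>Mor DE (block x) (block z)\<^esub> (b, a)"
    using f g' y Obj_block[of "block z" b]
    by (simp add: Comp_elementary_right_entry elementary_entry Comp_zero_left contracted_zero_entry)
qed simp_all

abbreviation idem :: "'o \<Rightarrow> 'o \<times> 'o \<Rightarrow> 'm" where
  "idem x \<equiv> elementary x x (Ident D x)"

text \<open>The right factor \<open>idem x\<close> keeps only column \<open>x\<close> and the left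
  factor \<open>idem y\<close> only row \<open>y\<close>. This is how a statement about an arbitrary
  matrix is reduced to one about a morphism of \<open>D\<close>.\<close>

lemma elementary_corner:
  assumes [simp]: "x \<in> Obj D" "y \<in> Obj D" and m: "m \<in> carrier (Mor DE (block x) (block y))"
  shows "Comp DE (block x) (block y) (block y) (idem y) (Comp DE (block x) (block x) (block y) m (idem x))
    = elementary y x (m (y, x))"
proof (rule contracted_eqI)
  note [simp] = elementary_closed contracted_Comp_closed Ident_closed contracted_entry_closed[OF m] m
  fix b a assume [simp]: "b \<in> E (block y)" "a \<in> E (block x)"
  have [simp]: "a \<in> Obj D" by (rule Obj_block[of "block x"]) simp_all
  show "Comp DE (block x) (block y) (block y) (idem y)
      (Comp DE (block x) (block x) (block y) m (idem x)) (b, a) = elementary y x (m (y, x)) (b, a)"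
    by (simp add: Comp_elementary_left_entry Comp_elementary_right_entry elementary_entry
        Comp_Ident_left Comp_Ident_right Comp_zero_right)
qed (simp_all add: elementary_closed contracted_Comp_closed Ident_closed contracted_entry_closed[OF m] m)

text \<open>At the entry \<open>(y, x)\<close> only the summand \<open>idem x\<close> can
  contribute, and it does so exactly on the diagonal.\<close>

lemma Ident_eq_sum_idem:
  assumes [simp]: "i \<in> I"
  shows "Ident DE i = finsum (Mor DE i i) idem (E i)"
proof (rule contracted_eqI)
  interpret ii: module k "Mor DE i i" by (simp add: contracted_Mor_module)
  have idem: "idem x \<in> carrier (Mor DE i i)" if "x \<in> E i" for x
    using elementary_closed[of x x "Ident D x"] Obj_block[of i x] that
    by (simp add: Ident_closed block_eq[OF assms that])
  show "finsum (Mor DE i i) idem (E i) \<in> carrier (Mor DE i i)"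
    using idem by (auto intro!: ii.finsum_closed)
  fix y x assume yx [simp]: "y \<in> E i" "x \<in> E i"
  then have obj [simp]: "y \<in> Obj D" "x \<in> Obj D" by (auto intro: Obj_block[of i])
  have "finsum (Mor D x y) (\<lambda>w. idem w (y, x)) (E i) = idem x (y, x)"
    by (intro abelian_monoid.finsum_eq_single Mor_abelian_monoid)
      (auto simp: finite_block elementary_entry Ident_closed block_eq[OF assms])
  then show "Ident DE i (y, x) = finsum (Mor DE i i) idem (E i) (y, x)"
    using idem by (simp add: contracted_finsum_entry contracted_Ident_entry elementary_entry block_eq[OF assms])
qed (simp_all add: contracted_Ident_closed)

end

section \<open>Functors to vector spaces\<close>

lemma
  assumes N: "linear_functor k C (vect k) N"
  shows vect_functor_module: "x \<in> Obj C \<Longrightarrow> module k (on_obj N x)"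
    and vect_functor_linear: "\<lbrakk>x \<in> Obj C; y \<in> Obj C; f \<in> carrier (Mor C x y)\<rbrakk>
      \<Longrightarrow> linear_map k (on_obj N x) (on_obj N y) (on_mor N x y f)"
    and vect_functor_Ident: "\<lbrakk>x \<in> Obj C; v \<in> carrier (on_obj N x)\<rbrakk> \<Longrightarrow> on_mor N x x (Ident C x) v = v"
    and vect_functor_Comp: "\<lbrakk>x \<in> Obj C; y \<in> Obj C; z \<in> Obj C; f \<in> carrier (Mor C x y);
        g \<in> carrier (Mor C y z); v \<in> carrier (on_obj N x)\<rbrakk>
      \<Longrightarrow> on_mor N x z (Comp C x y z g f) v = on_mor N y z g (on_mor N x y f v)"
  using linear_functor_obj[OF N] linear_functor_closed[OF N] linear_functor_Ident[OF N]
    linear_functor_Comp[OF N]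
  by (auto simp: compose_def)

text \<open>Linearity in the morphism with the vector fixed: it lets a zero morphism act as zero and
  a sum of morphisms act as the sum of their actions.\<close>

lemma vect_functor_linear_Mor:
  assumes N: "linear_functor k C (vect k) N" and "x \<in> Obj C" "y \<in> Obj C" "v \<in> carrier (on_obj N x)"
  shows "linear_map k (Mor C x y) (on_obj N y) (\<lambda>f. on_mor N x y f v)"
proof -
  note lin = linear_functor_linear[OF assms(1-3)]
  show ?thesis
    using assms(4) linear_map_closed[OF vect_functor_linear[OF assms(1-3)]]
    by (intro linear_mapI) (auto simp: linear_map_add[OF lin] linear_map_smult[OF lin])
qed

text \<open>All laws are checked on vectors; \<open>ext\<close> recovers equality of the morphisms
  of \<open>vect\<close> as functions.\<close>

lemma vect_functorI:
  assumes mod: "\<And>x. x \<in> Obj C \<Longrightarrow> module k (on_obj N x)"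
    and ext: "\<And>x y f. \<lbrakk>x \<in> Obj C; y \<in> Obj C; f \<in> carrier (Mor C x y)\<rbrakk>
      \<Longrightarrow> on_mor N x y f \<in> extensional (carrier (on_obj N x))"
    and lin: "\<And>x y f. \<lbrakk>x \<in> Obj C; y \<in> Obj C; f \<in> carrier (Mor C x y)\<rbrakk>
      \<Longrightarrow> linear_map k (on_obj N x) (on_obj N y) (on_mor N x y f)"
    and lin_Mor: "\<And>x y v. \<lbrakk>x \<in> Obj C; y \<in> Obj C; v \<in> carrier (on_obj N x)\<rbrakk>
      \<Longrightarrow> linear_map k (Mor C x y) (on_obj N y) (\<lambda>f. on_mor N x y f v)"
    and Ident: "\<And>x v. \<lbrakk>x \<in> Obj C; v \<in> carrier (on_obj N x)\<rbrakk> \<Longrightarrow> on_mor N x x (Ident C x) v = v"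
    and Comp: "\<And>x y z f g v. \<lbrakk>x \<in> Obj C; y \<in> Obj C; z \<in> Obj C; f \<in> carrier (Mor C x y);
        g \<in> carrier (Mor C y z); v \<in> carrier (on_obj N x)\<rbrakk>
      \<Longrightarrow> on_mor N x z (Comp C x y z g f) v = on_mor N y z g (on_mor N x y f v)"
    and C: "k_category k C"
  shows "linear_functor k C (vect k) N"
proof -
  interpret C: k_category k C by fact
  have Mor: "linear_map k (Mor C x y) (Mor (vect k) (on_obj N x) (on_obj N y)) (on_mor N x y)"
    if xy: "x \<in> Obj C" "y \<in> Obj C" for x y
  proof -
    interpret xy: module k "Mor C x y" using xy by (rule C.Mor_module)
    show ?thesis
      using xy
      by (intro linear_mapI)
        (auto simp: ext lin linear_map_add[OF lin_Mor[OF xy]] linear_map_smult[OF lin_Mor[OF xy]]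
          intro!: extensionalityI[of _ "carrier (on_obj N x)"])
  qed
  show ?thesis
  proof (rule linear_functorI)
    show "on_mor N x x (Ident C x) = Ident (vect k) (on_obj N x)" if "x \<in> Obj C" for x
      using that by (intro extensionalityI[of _ "carrier (on_obj N x)"])
        (auto simp: ext Ident C.Ident_closed)
    show "on_mor N x z (Comp C x y z g f) = Comp (vect k) (on_obj N x) (on_obj N y) (on_obj N z)
        (on_mor N y z g) (on_mor N x y f)"
      if "x \<in> Obj C" "y \<in> Obj C" "z \<in> Obj C" "f \<in> carrier (Mor C x y)" "g \<in> carrier (Mor C y z)"
      for x y z f g
      using that by (intro extensionalityI[of _ "carrier (on_obj N x)"])
        (auto simp: ext Comp C.Comp_closed compose_def)
  qed (auto simp: mod Mor simp del: vect_simps(2-))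
qed

lemma
  assumes "\<eta> \<in> nat_trans C (vect k) M N"
  shows vect_nat_trans_linear: "x \<in> Obj C \<Longrightarrow> linear_map k (on_obj M x) (on_obj N x) (\<eta> x)"
    and vect_nat_trans_extensional: "x \<in> Obj C \<Longrightarrow> \<eta> x \<in> extensional (carrier (on_obj M x))"
    and vect_nat_trans_natural:
      "\<lbrakk>x \<in> Obj C; y \<in> Obj C; f \<in> carrier (Mor C x y); v \<in> carrier (on_obj M x)\<rbrakk>
      \<Longrightarrow> \<eta> y (on_mor M x y f v) = on_mor N x y f (\<eta> x v)"
proof -
  show "\<eta> y (on_mor M x y f v) = on_mor N x y f (\<eta> x v)"
    if "x \<in> Obj C" "y \<in> Obj C" "f \<in> carrier (Mor C x y)" "v \<in> carrier (on_obj M x)"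
    using fun_cong[OF nat_trans_natural[OF assms that(1-3)], of v] that(4) by (simp add: compose_def)
qed (use nat_trans_closed[OF assms] in auto)

lemma restrict_vect_nat_transI:
  assumes M: "linear_functor k C (vect k) M"
    and lin: "\<And>x. x \<in> Obj C \<Longrightarrow> linear_map k (on_obj M x) (on_obj N x) (\<eta> x)"
    and nat: "\<And>x y f v. \<lbrakk>x \<in> Obj C; y \<in> Obj C; f \<in> carrier (Mor C x y); v \<in> carrier (on_obj M x)\<rbrakk>
      \<Longrightarrow> \<eta> y (on_mor M x y f v) = on_mor N x y f (\<eta> x v)"
  shows "(\<lambda>x\<in>Obj C. \<lambda>v\<in>carrier (on_obj M x). \<eta> x v) \<in> nat_trans C (vect k) M N"
proof (rule restrict_nat_transI)
  show "(\<lambda>v\<in>carrier (on_obj M x). \<eta> x v) \<in> carrier (Mor (vect k) (on_obj M x) (on_obj N x))"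
    if "x \<in> Obj C" for x
    using lin that by (simp add: linear_map_restrict[OF vect_functor_module[OF M]])
  show "Comp (vect k) (on_obj M x) (on_obj M y) (on_obj N y) (\<lambda>v\<in>carrier (on_obj M y). \<eta> y v) (on_mor M x y f)
      = Comp (vect k) (on_obj M x) (on_obj N x) (on_obj N y) (on_mor N x y f) (\<lambda>v\<in>carrier (on_obj M x). \<eta> x v)"
    if "x \<in> Obj C" "y \<in> Obj C" "f \<in> carrier (Mor C x y)" for x y f
    using that linear_map_closed[OF vect_functor_linear[OF M that]] nat
    by (auto simp: compose_def intro!: restrict_ext)
qed


section \<open>The corner functor\<close>

context contraction
begin

definition proj :: "('i, 'o \<times> 'o \<Rightarrow> 'm, ('k, 'v) module, 'v \<Rightarrow> 'v) kfunctor \<Rightarrow> 'o \<Rightarrow> 'v \<Rightarrow> 'v" where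
  "proj N x = on_mor N (block x) (block x) (idem x)"

text \<open>The image of an idempotent map is its set of fixed vectors. In this form membership is
  an equation, and the operations are those of the ambient space.\<close>

definition corner_space ::
  "('i, 'o \<times> 'o \<Rightarrow> 'm, ('k, 'v) module, 'v \<Rightarrow> 'v) kfunctor \<Rightarrow> 'o \<Rightarrow> ('k, 'v) module" where
  "corner_space N x = (on_obj N (block x))
    \<lparr>carrier := {v \<in> carrier (on_obj N (block x)). proj N x v = v}\<rparr>"

definition corner :: "('i, 'o \<times> 'o \<Rightarrow> 'm, ('k, 'v) module, 'v \<Rightarrow> 'v) kfunctor
    \<Rightarrow> ('o, 'm, ('k, 'v) module, 'v \<Rightarrow> 'v) kfunctor" where
  "corner N = \<lparr>on_obj = corner_space N,
    on_mor = (\<lambda>x y f. \<lambda>v\<in>carrier (corner_space N x). on_mor N (block x) (block y) (elementary y x f) v)\<rparr>"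

definition corner_functor :: "(('i, 'o \<times> 'o \<Rightarrow> 'm, ('k, 'v) module, 'v \<Rightarrow> 'v) kfunctor, 'i \<Rightarrow> 'v \<Rightarrow> 'v,
    ('o, 'm, ('k, 'v) module, 'v \<Rightarrow> 'v) kfunctor, 'o \<Rightarrow> 'v \<Rightarrow> 'v) kfunctor" where
  "corner_functor = \<lparr>on_obj = corner,
    on_mor = (\<lambda>N N' \<phi>. \<lambda>x\<in>Obj D. \<lambda>v\<in>carrier (corner_space N x). \<phi> (block x) v)\<rparr>"

lemma corner_space_simps [simp]:
  "v \<in> carrier (corner_space N x) \<longleftrightarrow> v \<in> carrier (on_obj N (block x)) \<and> proj N x v = v"
  "u \<oplus>\<^bsub>corner_space N x\<^esub> v = u \<oplus>\<^bsub>on_obj N (block x)\<^esub> v"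
  "a \<odot>\<^bsub>corner_space N x\<^esub> v = a \<odot>\<^bsub>on_obj N (block x)\<^esub> v"
  "\<zero>\<^bsub>corner_space N x\<^esub> = \<zero>\<^bsub>on_obj N (block x)\<^esub>"
  by (simp_all add: corner_space_def)

lemma corner_simps [simp]:
  "on_obj (corner N) = corner_space N"
  "on_mor (corner N) x y f
    = (\<lambda>v\<in>carrier (corner_space N x). on_mor N (block x) (block y) (elementary y x f) v)"
  by (simp_all add: corner_def)

lemma corner_functor_simps [simp]:
  "on_obj corner_functor = corner"
  "on_mor corner_functor N N' \<phi> = (\<lambda>x\<in>Obj D. \<lambda>v\<in>carrier (corner_space N x). \<phi> (block x) v)"
  by (simp_all add: corner_functor_def)

lemma idem_closed [simp]: "x \<in> Obj D \<Longrightarrow> idem x \<in> carrier (Mor DE (block x) (block x))"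
  by (simp add: elementary_closed Ident_closed)

section \<open>Decomposition of a module over the contracted category into its corners\<close>

context
  fixes N :: "('i, 'o \<times> 'o \<Rightarrow> 'm, ('k, 'v) module, 'v \<Rightarrow> 'v) kfunctor"
  assumes N: "linear_functor k DE (vect k) N"
begin

lemma contracted_module: "i \<in> I \<Longrightarrow> module k (on_obj N i)"
  using vect_functor_module[OF N] by simp

lemma proj_linear: "x \<in> Obj D \<Longrightarrow> linear_map k (on_obj N (block x)) (on_obj N (block x)) (proj N x)"
  unfolding proj_def using vect_functor_linear[OF N] by simp

text \<open>Multiplying \<open>elementary y x f\<close> by \<open>idem y\<close> from the left
  replaces \<open>f\<close> by its composite with the identity of \<open>y\<close>, hence changes
  nothing. Single-entry matrices in row \<open>y\<close> therefore map into the corner at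
  \<open>y\<close>.\<close>

lemma proj_elementary:
  assumes "x \<in> Obj D" "y \<in> Obj D" "f \<in> carrier (Mor D x y)" "v \<in> carrier (on_obj N (block x))"
  shows "proj N y (on_mor N (block x) (block y) (elementary y x f) v)
    = on_mor N (block x) (block y) (elementary y x f) v"
  using assms vect_functor_Comp[OF N, of "block x" "block y" "block y" "elementary y x f" "idem y" v]
  by (simp add: proj_def elementary_Comp elementary_closed Ident_closed Comp_Ident_left)

lemma proj_corner:
  assumes "x \<in> Obj D" "v \<in> carrier (on_obj N (block x))"
  shows "proj N x v \<in> carrier (corner_space N x)"
  using assms proj_elementary[of x x "Ident D x" v] linear_map_closed[OF proj_linear]
  by (simp add: Ident_closed proj_def)

text \<open>Write \<open>v\<close> as its own projection at \<open>x\<close>; then the product of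
  \<open>idem y\<close> and \<open>idem x\<close>, which is the zero matrix, acts on it.\<close>

lemma proj_other:
  assumes "x \<in> Obj D" "y \<in> Obj D" "block y = block x" "y \<noteq> x" "v \<in> carrier (corner_space N x)"
  shows "proj N y v = \<zero>\<^bsub>on_obj N (block x)\<^esub>"
proof -
  have v: "v \<in> carrier (on_obj N (block x))" "proj N x v = v" using assms by auto
  have "proj N y v = proj N y (proj N x v)" using v by simp
  also have "\<dots> = on_mor N (block x) (block x) (Comp DE (block x) (block x) (block x) (idem y) (idem x)) v"
    using assms v idem_closed[of y]
    by (subst vect_functor_Comp[OF N]) (simp_all add: proj_def)
  also have "Comp DE (block x) (block x) (block x) (idem y) (idem x) = \<zero>\<^bsub>Mor DE (block x) (block x)\<^esub>"
    using elementary_Comp_zero[of x x y y "Ident D x" "Ident D y"] assms by (simp add: Ident_closed)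
  also have "on_mor N (block x) (block x) \<zero>\<^bsub>Mor DE (block x) (block x)\<^esub> v = \<zero>\<^bsub>on_obj N (block x)\<^esub>"
    using assms v by (intro linear_map_zero[OF _ _ vect_functor_linear_Mor[OF N]])
      (auto intro: contracted_Mor_module contracted_module)
  finally show ?thesis .
qed

text \<open>Let the identity matrix, written as a sum of idempotents, act on \<open>v\<close>, and
  use linearity of the action in the matrix.\<close>

lemma sum_proj:
  assumes i: "i \<in> I" and v: "v \<in> carrier (on_obj N i)"
  shows "finsum (on_obj N i) (\<lambda>x. proj N x v) (E i) = v"
proof -
  interpret Ni: module k "on_obj N i" using i by (rule contracted_module)
  have idem: "idem x \<in> carrier (Mor DE i i)" if "x \<in> E i" for x
    using idem_closed[of x] Obj_block[OF i that] block_eq[OF i that] by simp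
  have "v = on_mor N i i (finsum (Mor DE i i) idem (E i)) v"
    using vect_functor_Ident[OF N, of i v] i v by (simp add: Ident_eq_sum_idem)
  also have "\<dots> = finsum (on_obj N i) (\<lambda>x. on_mor N i i (idem x) v) (E i)"
    using i v idem by (intro linear_map_finsum[OF _ _ vect_functor_linear_Mor[OF N]])
      (auto intro: contracted_Mor_module contracted_module)
  also have "\<dots> = finsum (on_obj N i) (\<lambda>x. proj N x v) (E i)"
    using i v idem linear_map_closed[OF vect_functor_linear[OF N]] block_eq[OF i]
    by (intro Ni.finsum_cong') (auto simp: proj_def)
  finally show ?thesis by simp
qed

text \<open>Each vector is the sum of its projections. Through this, equations in a module over the
  contracted category are tested one corner at a time.\<close>

lemma proj_separates:
  assumes i: "i \<in> I" and u: "u \<in> carrier (on_obj N i)" and v: "v \<in> carrier (on_obj N i)"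
    and eq: "\<And>x. x \<in> E i \<Longrightarrow> proj N x u = proj N x v"
  shows "u = v"
proof -
  interpret Ni: module k "on_obj N i" using i by (rule contracted_module)
  have "finsum (on_obj N i) (\<lambda>x. proj N x u) (E i) = finsum (on_obj N i) (\<lambda>x. proj N x v) (E i)"
    using i v linear_map_closed[OF proj_linear] block_eq[OF i] Obj_block[OF i]
    by (intro Ni.finsum_cong') (fastforce simp: eq)+
  then show ?thesis using sum_proj[OF i] u v by simp
qed

text \<open>As \<open>v\<close> is fixed by \<open>idem x\<close>, the matrix \<open>m\<close> may
  be replaced by its product with \<open>idem x\<close> on the right and \<open>idem y\<close> on
  the left, which is a single entry by \<open>elementary_corner\<close>.\<close>

lemma proj_on_mor:
  assumes "x \<in> Obj D" "y \<in> Obj D" "m \<in> carrier (Mor DE (block x) (block y))" "v \<in> carrier (corner_space N x)"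
  shows "proj N y (on_mor N (block x) (block y) m v)
    = on_mor N (block x) (block y) (elementary y x (m (y, x))) v"
proof -
  have v: "v \<in> carrier (on_obj N (block x))" "proj N x v = v" using assms by auto
  have "proj N y (on_mor N (block x) (block y) m v) = proj N y (on_mor N (block x) (block y) m (proj N x v))"
    using v by simp
  also have "\<dots> = on_mor N (block x) (block y) (Comp DE (block x) (block y) (block y) (idem y)
      (Comp DE (block x) (block x) (block y) m (idem x))) v"
    using assms v by (simp add: vect_functor_Comp[OF N] contracted_Comp_closed proj_def)
  finally show ?thesis
    using assms by (simp add: elementary_corner)
qed

lemma corner_space_module:
  assumes x: "x \<in> Obj D"
  shows "module k (corner_space N x)"
proof -
  interpret Nx: module k "on_obj N (block x)" using x by (intro contracted_module) simp
  note lin = proj_linear[OF x]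
  have "submodule {v \<in> carrier (on_obj N (block x)). proj N x v = v} k (on_obj N (block x))"
  proof (rule Nx.submoduleI)
    fix v assume v: "v \<in> {v \<in> carrier (on_obj N (block x)). proj N x v = v}"
    have "proj N x (\<ominus> \<one> \<odot>\<^bsub>on_obj N (block x)\<^esub> v) = \<ominus> \<one> \<odot>\<^bsub>on_obj N (block x)\<^esub> v"
      using v by (subst linear_map_smult[OF lin]) auto
    then show "\<ominus>\<^bsub>on_obj N (block x)\<^esub> v \<in> {v \<in> carrier (on_obj N (block x)). proj N x v = v}"
      using v by (simp add: Nx.smult_l_minus)
  qed (use linear_map_zero[OF Nx.module_axioms Nx.module_axioms lin] in
      \<open>auto simp: linear_map_add[OF lin] linear_map_smult[OF lin]\<close>)
  then show ?thesis
    unfolding corner_space_def by (rule submodule.submodule_is_module) (rule Nx.module_axioms)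
qed

lemma corner_linear:
  assumes "x \<in> Obj D" "y \<in> Obj D" "f \<in> carrier (Mor D x y)"
  shows "linear_map k (corner_space N x) (corner_space N y) (on_mor N (block x) (block y) (elementary y x f))"
proof -
  have lin: "linear_map k (on_obj N (block x)) (on_obj N (block y)) (on_mor N (block x) (block y) (elementary y x f))"
    using assms vect_functor_linear[OF N] by (simp add: elementary_closed)
  show ?thesis
    by (rule linear_mapI)
      (use assms in \<open>auto simp: proj_elementary linear_map_closed[OF lin] linear_map_add[OF lin] linear_map_smult[OF lin]\<close>)
qed

lemma linear_functor_corner: "linear_functor k D (vect k) (corner N)"
proof (rule vect_functorI)
  fix x y v assume xy: "x \<in> Obj D" "y \<in> Obj D" and v: "v \<in> carrier (on_obj (corner N) x)"
  have lin: "linear_map k (Mor D x y) (on_obj N (block y)) (\<lambda>f. on_mor N (block x) (block y) (elementary y x f) v)"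
    using xy v by (intro linear_map_comp[OF elementary_linear vect_functor_linear_Mor[OF N]]) auto
  show "linear_map k (Mor D x y) (on_obj (corner N) y) (\<lambda>f. on_mor (corner N) x y f v)"
    using xy v by (intro linear_mapI)
      (auto simp: proj_elementary linear_map_closed[OF lin] linear_map_add[OF lin] linear_map_smult[OF lin])
next
  fix x v assume "x \<in> Obj D" "v \<in> carrier (on_obj (corner N) x)"
  \<comment> \<open>The identity of \<open>x\<close> acts through \<open>idem x\<close>, and the
    corner consists of the vectors that \<open>idem x\<close> fixes.\<close>
  then show "on_mor (corner N) x x (Ident D x) v = v"
    by (simp add: proj_def)
next
  fix x y z f g v
  assume *: "x \<in> Obj D" "y \<in> Obj D" "z \<in> Obj D" "f \<in> carrier (Mor D x y)" "g \<in> carrier (Mor D y z)"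
    "v \<in> carrier (on_obj (corner N) x)"
  then have "on_mor N (block x) (block y) (elementary y x f) v \<in> carrier (corner_space N y)"
    by (intro linear_map_closed[OF corner_linear]) auto
  with * show "on_mor (corner N) x z (Comp D x y z g f) v = on_mor (corner N) y z g (on_mor (corner N) x y f v)"
    by (simp add: elementary_closed vect_functor_Comp[OF N] flip: elementary_Comp)
qed (auto simp: corner_space_module corner_linear linear_map_restrict k_category_axioms
    simp del: corner_space_simps)

end


section \<open>Passing to corners as a fully faithful functor\<close>

lemma proj_natural:
  assumes "\<phi> \<in> nat_trans DE (vect k) N N'" "x \<in> Obj D" "v \<in> carrier (on_obj N (block x))"
  shows "proj N' x (\<phi> (block x) v) = \<phi> (block x) (proj N x v)"
  using vect_nat_trans_natural[OF assms(1), of "block x" "block x" "idem x" v] assms(2,3)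
  by (simp add: proj_def)

text \<open>Naturality at the idempotents makes \<open>\<phi>\<close> preserve corners; naturality
  at the other single-entry matrices makes its restrictions natural over \<open>D\<close>.\<close>

lemma nat_trans_corner:
  assumes N: "linear_functor k DE (vect k) N" and N': "linear_functor k DE (vect k) N'"
    and \<phi>: "\<phi> \<in> nat_trans DE (vect k) N N'"
  shows "on_mor corner_functor N N' \<phi> \<in> nat_trans D (vect k) (corner N) (corner N')"
proof -
  have lin: "linear_map k (on_obj N (block x)) (on_obj N' (block x)) (\<phi> (block x))" if "x \<in> Obj D" for x
    using vect_nat_trans_linear[OF \<phi>] that by simp
  have corner: "linear_map k (corner_space N x) (corner_space N' x) (\<phi> (block x))" if "x \<in> Obj D" for x
    using that by (intro linear_mapI)
      (auto simp: linear_map_closed[OF lin] linear_map_add[OF lin] linear_map_smult[OF lin] proj_natural[OF \<phi>])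
  have "(\<lambda>x\<in>Obj D. \<lambda>v\<in>carrier (on_obj (corner N) x). \<phi> (block x) v)
      \<in> nat_trans D (vect k) (corner N) (corner N')"
  proof (rule restrict_vect_nat_transI[OF linear_functor_corner[OF N]])
    fix x y f v
    assume x: "x \<in> Obj D" and "y \<in> Obj D" "f \<in> carrier (Mor D x y)" "v \<in> carrier (on_obj (corner N) x)"
    then show "\<phi> (block y) (on_mor (corner N) x y f v) = on_mor (corner N') x y f (\<phi> (block x) v)"
      using vect_nat_trans_natural[OF \<phi>, of "block x" "block y" "elementary y x f" v]
        linear_map_closed[OF corner[OF x], of v]
      by (simp add: elementary_closed)
  qed (simp add: corner)
  then show ?thesis by simp
qed

lemma corner_functor_linear:
  assumes N: "linear_functor k DE (vect k) N" and N': "linear_functor k DE (vect k) N'"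
  shows "linear_map k (Mor (functor_category k DE (vect k)) N N')
      (Mor (functor_category k D (vect k)) (corner N) (corner N')) (on_mor corner_functor N N')"
  by (rule linear_mapI) (use nat_trans_corner[OF N N'] in \<open>auto intro!: restrict_ext\<close>)

lemma corner_functor_Comp:
  assumes "\<phi> \<in> nat_trans DE (vect k) N N'" "\<psi> \<in> nat_trans DE (vect k) N' N''"
  shows "on_mor corner_functor N N'' (Comp (functor_category k DE (vect k)) N N' N'' \<psi> \<phi>)
    = Comp (functor_category k D (vect k)) (corner N) (corner N') (corner N'')
        (on_mor corner_functor N' N'' \<psi>) (on_mor corner_functor N N' \<phi>)"
proof -
  have "\<phi> (block x) v \<in> carrier (on_obj N' (block x))"
    if "x \<in> Obj D" "v \<in> carrier (on_obj N (block x))" for x v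
    using linear_map_closed[OF vect_nat_trans_linear[OF assms(1)]] that by simp
  then show ?thesis
    by (auto simp: compose_def proj_natural[OF assms(1)] intro!: restrict_ext)
qed

lemma linear_functor_corner_functor:
  "linear_functor k (functor_category k DE (vect k)) (functor_category k D (vect k)) corner_functor"
proof (rule linear_functorI, unfold corner_functor_simps(1), goal_cases)
  case (3 N)
  show ?case by (auto intro!: restrict_ext)
qed (use linear_functor_corner corner_functor_linear corner_functor_Comp in auto)

text \<open>By naturality, the projection of \<open>\<phi> i v\<close> at \<open>x\<close> is the
  value of \<open>\<phi> i\<close> on the projection of \<open>v\<close>, a vector of a corner,
  where the two transformations agree. Projections determine the vector.\<close>

lemma corner_functor_faithful:
  assumes N: "linear_functor k DE (vect k) N" and N': "linear_functor k DE (vect k) N'"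
    and \<phi>: "\<phi> \<in> nat_trans DE (vect k) N N'" and \<psi>: "\<psi> \<in> nat_trans DE (vect k) N N'"
    and eq: "on_mor corner_functor N N' \<phi> = on_mor corner_functor N N' \<psi>"
  shows "\<phi> = \<psi>"
proof (rule extensionalityI[of _ I])
  show "\<phi> \<in> extensional I" "\<psi> \<in> extensional I"
    using nat_trans_extensional[OF \<phi>] nat_trans_extensional[OF \<psi>] by auto
  fix i assume i: "i \<in> I"
  have corner: "\<phi> (block x) v = \<psi> (block x) v" if "x \<in> Obj D" "v \<in> carrier (corner_space N x)" for x v
    using fun_cong[OF fun_cong[OF eq, of x], of v] that by simp
  show "\<phi> i = \<psi> i"
  proof (rule extensionalityI)
    show "\<phi> i \<in> extensional (carrier (on_obj N i))" "\<psi> i \<in> extensional (carrier (on_obj N i))"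
      using i vect_nat_trans_extensional[OF \<phi>] vect_nat_trans_extensional[OF \<psi>] by auto
    fix v assume v: "v \<in> carrier (on_obj N i)"
    show "\<phi> i v = \<psi> i v"
    proof (rule proj_separates[OF N' i])
      show "\<phi> i v \<in> carrier (on_obj N' i)" "\<psi> i v \<in> carrier (on_obj N' i)"
        using i v vect_nat_trans_linear[OF \<phi>] vect_nat_trans_linear[OF \<psi>]
        by (auto intro: linear_map_closed)
      fix x assume "x \<in> E i"
      with i have x: "x \<in> Obj D" "block x = i" by (auto intro: Obj_block block_eq)
      then show "proj N' x (\<phi> i v) = proj N' x (\<psi> i v)"
        using proj_natural[OF \<phi> x(1)] proj_natural[OF \<psi> x(1)] v corner[OF x(1) proj_corner[OF N x(1)]]
        by simp
    qed
  qed
qed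

text \<open>A transformation given on corners is extended additively along the decomposition of
  \<open>N i\<close>; the work lies in naturality with respect to matrices that mix corners.\<close>

lemma corner_functor_full:
  assumes N: "linear_functor k DE (vect k) N" and N': "linear_functor k DE (vect k) N'"
    and \<theta>: "\<theta> \<in> nat_trans D (vect k) (corner N) (corner N')"
  obtains \<phi> where "\<phi> \<in> nat_trans DE (vect k) N N'" "on_mor corner_functor N N' \<phi> = \<theta>"
proof -
  have \<theta>_lin: "linear_map k (corner_space N x) (corner_space N' x) (\<theta> x)" if "x \<in> Obj D" for x
    using vect_nat_trans_linear[OF \<theta>] that by simp
  \<comment> \<open>Forced by linearity: a vector is the sum of its projections, and on the corner
    at \<open>x\<close> the extension has to be \<open>\<theta> x\<close>.\<close>
  define \<phi> where "\<phi> i v = finsum (on_obj N' i) (\<lambda>x. \<theta> x (proj N x v)) (E i)" for i v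
  have \<theta>_proj: "\<theta> x (proj N x v) \<in> carrier (corner_space N' x)"
    if "x \<in> Obj D" "v \<in> carrier (on_obj N (block x))" for x v
    using that by (intro linear_map_closed[OF \<theta>_lin] proj_corner[OF N])
  have \<theta>_proj': "\<theta> x (proj N x v) \<in> carrier (on_obj N' i)"
    if "i \<in> I" "x \<in> E i" "v \<in> carrier (on_obj N i)" for i x v
    using \<theta>_proj[of x v] Obj_block[OF that(1,2)] block_eq[OF that(1,2)] that by simp
  have \<phi>_closed: "\<phi> i v \<in> carrier (on_obj N' i)" if i: "i \<in> I" and v: "v \<in> carrier (on_obj N i)" for i v
  proof -
    interpret module k "on_obj N' i" using i by (rule contracted_module[OF N'])
    show ?thesis
      unfolding \<phi>_def using \<theta>_proj' i v by (intro finsum_closed) auto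
  qed
  \<comment> \<open>The summand at \<open>y\<close> lies in the corner of \<open>N'\<close> at
    \<open>y\<close>, which the projection at \<open>x\<close> kills unless \<open>y\<close> is
    \<open>x\<close>.\<close>
  have proj_\<phi>: "proj N' x (\<phi> (block x) v) = \<theta> x (proj N x v)"
    if x: "x \<in> Obj D" and v: "v \<in> carrier (on_obj N (block x))" for x v
  proof -
    interpret module k "on_obj N' (block x)" using x by (intro contracted_module[OF N']) simp
    have "proj N' x (\<phi> (block x) v)
        = finsum (on_obj N' (block x)) (\<lambda>y. proj N' x (\<theta> y (proj N y v))) (E (block x))"
      unfolding \<phi>_def using x v \<theta>_proj'[of "block x"]
      by (intro linear_map_finsum[OF module_axioms module_axioms proj_linear[OF N']]) auto
    also have "\<dots> = proj N' x (\<theta> x (proj N x v))"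
    proof (rule finsum_eq_single)
      fix y assume y: "y \<in> E (block x)" "y \<noteq> x"
      then have y': "y \<in> Obj D" "block y = block x" using x by (auto intro: Obj_block[of "block x"] block_eq)
      then show "proj N' x (\<theta> y (proj N y v)) = \<zero>\<^bsub>on_obj N' (block x)\<^esub>"
        using proj_other[OF N', of y x "\<theta> y (proj N y v)"] x y v \<theta>_proj[of y v] by simp
    qed (use x \<theta>_proj[OF x v] in \<open>auto simp: finite_block\<close>)
    finally show ?thesis using \<theta>_proj[OF x v] by simp
  qed
  have \<phi>_corner: "\<phi> (block x) v = \<theta> x v" if x: "x \<in> Obj D" and v: "v \<in> carrier (corner_space N x)" for x v
  proof (rule proj_separates[OF N'])
    show "\<phi> (block x) v \<in> carrier (on_obj N' (block x))" using x v by (simp add: \<phi>_closed)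
    have \<theta>v: "\<theta> x v \<in> carrier (corner_space N' x)" using linear_map_closed[OF \<theta>_lin[OF x] v] .
    then show "\<theta> x v \<in> carrier (on_obj N' (block x))" by simp
    fix y assume "y \<in> E (block x)"
    with x have y: "y \<in> Obj D" "block y = block x" by (auto intro: Obj_block[of "block x"] block_eq)
    have *: "proj N' y (\<phi> (block x) v) = \<theta> y (proj N y v)"
      using proj_\<phi>[OF y(1)] y(2) v by simp
    show "proj N' y (\<phi> (block x) v) = proj N' y (\<theta> x v)"
    proof (cases "y = x")
      case True
      then show ?thesis using * v \<theta>v by simp
    next
      case False
      \<comment> \<open>For distinct objects of one block both sides vanish: orthogonality kills the
        projections at \<open>y\<close> of \<open>v\<close> and of \<open>\<theta> x v\<close>, and
        the linear map \<open>\<theta> y\<close> preserves zero.\<close>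
      have "\<theta> y \<zero>\<^bsub>corner_space N y\<^esub> = \<zero>\<^bsub>corner_space N' y\<^esub>"
        using y by (intro linear_map_zero[OF _ _ \<theta>_lin] corner_space_module[OF N] corner_space_module[OF N'])
      then show ?thesis
        using * proj_other[OF N x y False v] proj_other[OF N' x y False \<theta>v] y(2) by simp
    qed
  qed (use x in simp)
  have \<phi>_lin: "linear_map k (on_obj N i) (on_obj N' i) (\<phi> i)" if i: "i \<in> I" for i
    unfolding \<phi>_def
  proof (rule linear_map_finsum_pointwise)
    fix x assume x: "x \<in> E i"
    then have x': "x \<in> Obj D" "block x = i" using i by (auto intro: Obj_block block_eq)
    have pl: "linear_map k (on_obj N i) (on_obj N i) (proj N x)"
      using proj_linear[OF N x'(1)] x'(2) by simp
    show "linear_map k (on_obj N i) (on_obj N' i) (\<lambda>v. \<theta> x (proj N x v))"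
      using \<theta>_proj'[OF i x] x' proj_corner[OF N x'(1)] linear_map_add[OF \<theta>_lin[OF x'(1)]]
        linear_map_smult[OF \<theta>_lin[OF x'(1)]]
      by (intro linear_mapI) (auto simp: linear_map_add[OF pl] linear_map_smult[OF pl])
  qed (use i in \<open>auto intro: contracted_module[OF N] contracted_module[OF N']\<close>)
  txt \<open>Both sides are linear in \<open>v\<close>, so \<open>v\<close> may be taken in a corner, and then the projections onto
    the corners of the target see single entries of \<open>m\<close>.\<close>
  have \<phi>_nat: "\<phi> j (on_mor N i j m v) = on_mor N' i j m (\<phi> i v)"
    if ij: "i \<in> I" "j \<in> I" and m: "m \<in> carrier (Mor DE i j)" and v: "v \<in> carrier (on_obj N i)" for i j m v
  proof -
    have Nm: "linear_map k (on_obj N i) (on_obj N j) (on_mor N i j m)"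
      and N'm: "linear_map k (on_obj N' i) (on_obj N' j) (on_mor N' i j m)"
      using vect_functor_linear[OF N] vect_functor_linear[OF N'] ij m by auto
    interpret Ni: module k "on_obj N i" using ij by (intro contracted_module[OF N])
    interpret N'j: module k "on_obj N' j" using ij by (intro contracted_module[OF N'])
    have lhs: "linear_map k (on_obj N i) (on_obj N' j) (\<lambda>v. \<phi> j (on_mor N i j m v))"
      by (rule linear_map_comp[OF Nm \<phi>_lin[OF ij(2)]])
    have rhs: "linear_map k (on_obj N i) (on_obj N' j) (\<lambda>v. on_mor N' i j m (\<phi> i v))"
      by (rule linear_map_comp[OF \<phi>_lin[OF ij(1)] N'm])
    have corner: "\<phi> j (on_mor N i j m u) = on_mor N' i j m (\<phi> i u)"
      if x: "x \<in> E i" and u: "u \<in> carrier (corner_space N x)" for x u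
    proof (rule proj_separates[OF N' ij(2)])
      have x': "x \<in> Obj D" "block x = i" using x ij by (auto intro: Obj_block block_eq)
      have u': "u \<in> carrier (on_obj N i)" using u x' by simp
      show "\<phi> j (on_mor N i j m u) \<in> carrier (on_obj N' j)" "on_mor N' i j m (\<phi> i u) \<in> carrier (on_obj N' j)"
        using linear_map_closed[OF lhs u'] linear_map_closed[OF rhs u'] by auto
      fix y assume y: "y \<in> E j"
      have y': "y \<in> Obj D" "block y = j" using y ij by (auto intro: Obj_block block_eq)
      have myx: "m (y, x) \<in> carrier (Mor D x y)"
        using m ij x y by (simp add: contracted_entry_closed)
      have \<theta>u: "\<theta> x u \<in> carrier (corner_space N' x)" by (rule linear_map_closed[OF \<theta>_lin[OF x'(1)] u])
      have "proj N' y (\<phi> j (on_mor N i j m u)) = \<theta> y (proj N y (on_mor N i j m u))"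
        using proj_\<phi>[OF y'(1), of "on_mor N i j m u"] linear_map_closed[OF Nm u'] y'(2) by simp
      also have "\<dots> = \<theta> y (on_mor N i j (elementary y x (m (y, x))) u)"
        using proj_on_mor[OF N x'(1) y'(1), of m u] x'(2) y'(2) m u by simp
      \<comment> \<open>With the matrix reduced to the entry \<open>m (y, x)\<close>, a morphism of
        \<open>D\<close>, naturality of \<open>\<theta>\<close> over \<open>D\<close>
        applies.\<close>
      also have "\<dots> = on_mor N' i j (elementary y x (m (y, x))) (\<theta> x u)"
        using vect_nat_trans_natural[OF \<theta> x'(1) y'(1) myx, of u] x'(2) y'(2) u \<theta>u by simp
      also have "\<dots> = proj N' y (on_mor N' i j m (\<phi> i u))"
        using proj_on_mor[OF N' x'(1) y'(1), of m "\<theta> x u"] x'(2) y'(2) m \<theta>u \<phi>_corner[OF x'(1) u] by simp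
      finally show "proj N' y (\<phi> j (on_mor N i j m u)) = proj N' y (on_mor N' i j m (\<phi> i u))" .
    qed
    have pc: "proj N x v \<in> carrier (corner_space N x)" "proj N x v \<in> carrier (on_obj N i)"
      if x: "x \<in> E i" for x
      using proj_corner[OF N, of x v] Obj_block[OF ij(1) x] block_eq[OF ij(1) x] v by auto
    have "\<phi> j (on_mor N i j m v) = finsum (on_obj N' j) (\<lambda>x. \<phi> j (on_mor N i j m (proj N x v))) (E i)"
      using linear_map_finsum[OF Ni.module_axioms N'j.module_axioms lhs, of "\<lambda>x. proj N x v" "E i"]
        pc sum_proj[OF N ij(1) v] by auto
    also have "\<dots> = finsum (on_obj N' j) (\<lambda>x. on_mor N' i j m (\<phi> i (proj N x v))) (E i)"
      using pc corner linear_map_closed[OF rhs] by (intro N'j.finsum_cong') auto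
    also have "\<dots> = on_mor N' i j m (\<phi> i v)"
      using linear_map_finsum[OF Ni.module_axioms N'j.module_axioms rhs, of "\<lambda>x. proj N x v" "E i"]
        pc sum_proj[OF N ij(1) v] by auto
    finally show ?thesis .
  qed
  have "(\<lambda>i\<in>Obj DE. \<lambda>v\<in>carrier (on_obj N i). \<phi> i v) \<in> nat_trans DE (vect k) N N'"
    by (rule restrict_vect_nat_transI[OF N]) (simp_all add: \<phi>_lin \<phi>_nat)
  moreover have "on_mor corner_functor N N' (\<lambda>i\<in>Obj DE. \<lambda>v\<in>carrier (on_obj N i). \<phi> i v) = \<theta>"
  proof (rule extensionalityI[OF _ nat_trans_extensional[OF \<theta>]])
    fix x assume x: "x \<in> Obj D"
    show "on_mor corner_functor N N' (\<lambda>i\<in>Obj DE. \<lambda>v\<in>carrier (on_obj N i). \<phi> i v) x = \<theta> x"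
      using x \<phi>_corner[OF x] vect_nat_trans_extensional[OF \<theta> x]
      by (intro extensionalityI[of _ "carrier (corner_space N x)"]) auto
  qed simp
  ultimately show ?thesis using that by blast
qed

end

section \<open>Transport of structure\<close>

text \<open>An infinite type is in bijection with its square, so a function on
  \<open>insert a A\<close> is encoded by the pair of its value at \<open>a\<close> and the code of
  its restriction to \<open>A\<close>.\<close>

lemma exists_inj_on_extensional_infinite:
  assumes "finite A"
  shows "\<exists>e :: ('a \<Rightarrow> 'v::infinite) \<Rightarrow> 'v. inj_on e (extensional A)"
  using assms
proof (induction A)
  case empty
  \<comment> \<open>The only element of \<open>extensional {}\<close> is the function that is
    \<open>undefined\<close> everywhere, so any \<open>e\<close> will do.\<close>
  then show ?case by (simp add: inj_on_def)
next
  case (insert a A)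
  then obtain e :: "('a \<Rightarrow> 'v) \<Rightarrow> 'v" where e: "inj_on e (extensional A)" by blast
  obtain p :: "'v \<times> 'v \<Rightarrow> 'v" where "bij_betw p (UNIV \<times> UNIV) UNIV"
    using iffD2[OF card_of_ordIso card_of_Times_same_infinite[OF infinite_UNIV]] by (elim exE)
  then have p: "inj p"
    by (simp add: bij_betw_def)
  have "inj_on (\<lambda>g. p (g a, e (restrict g A))) (extensional (insert a A))"
  proof (rule inj_onI)
    fix g h
    assume g: "g \<in> extensional (insert a A)" and h: "h \<in> extensional (insert a A)"
      and "p (g a, e (restrict g A)) = p (h a, e (restrict h A))"
    then have a: "g a = h a" and "restrict g A = restrict h A"
      using e by (auto simp: inj_eq[OF p] dest: inj_onD)
    then have "g b = h b" if "b \<in> A" for b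
      using that by (metis restrict_apply')
    then show "g = h"
      using a by (intro extensionalityI[OF g h]) auto
  qed
  then show ?case by blast
qed

text \<open>The structure of \<open>V\<close> carried along \<open>e\<close>, meaningful when
  \<open>e\<close> is injective on the carrier. It moves spaces whose vectors are functions into the
  universe \<open>'v\<close>.\<close>

definition transport :: "('w \<Rightarrow> 'v) \<Rightarrow> ('k, 'w) module \<Rightarrow> ('k, 'v) module" where
  "transport e V =
     \<lparr>carrier = e ` carrier V, monoid.mult = undefined, one = undefined,
      zero = e \<zero>\<^bsub>V\<^esub>,
      add = (\<lambda>a b. e (inv_into (carrier V) e a \<oplus>\<^bsub>V\<^esub> inv_into (carrier V) e b)),
      smult = (\<lambda>c a. e (c \<odot>\<^bsub>V\<^esub> inv_into (carrier V) e a))\<rparr>"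

lemma transport_simps [simp]:
  "carrier (transport e V) = e ` carrier V"
  "\<zero>\<^bsub>transport e V\<^esub> = e \<zero>\<^bsub>V\<^esub>"
  by (simp_all add: transport_def)

lemma transport_ops [simp]:
  assumes "inj_on e (carrier V)" "u \<in> carrier V"
  shows "v \<in> carrier V \<Longrightarrow> e u \<oplus>\<^bsub>transport e V\<^esub> e v = e (u \<oplus>\<^bsub>V\<^esub> v)"
    and "a \<odot>\<^bsub>transport e V\<^esub> e u = e (a \<odot>\<^bsub>V\<^esub> u)"
  using assms by (simp_all add: transport_def)

lemma module_transport:
  assumes "module k V" "inj_on e (carrier V)"
  shows "module k (transport e V)"
proof -
  interpret V: module k V by fact
  note [simp] = transport_ops[OF assms(2)]
  have "abelian_group (transport e V)"
  proof (rule abelian_groupI)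
    fix u assume "u \<in> carrier (transport e V)"
    then obtain v where "v \<in> carrier V" "u = e v" by auto
    then show "\<exists>w\<in>carrier (transport e V). w \<oplus>\<^bsub>transport e V\<^esub> u = \<zero>\<^bsub>transport e V\<^esub>"
      by (intro bexI[of _ "e (\<ominus>\<^bsub>V\<^esub> v)"]) (auto simp: V.M.l_neg)
  qed (auto simp: V.M.a_assoc intro: arg_cong[OF V.M.a_comm])
  then show ?thesis
    by (rule moduleI[OF V.R.is_cring])
      (auto simp: V.smult_l_distr V.smult_r_distr V.smult_assoc1)
qed

lemma linear_map_transport:
  assumes "inj_on e (carrier V)"
  shows "linear_map k V (transport e V) e"
  using assms by (intro linear_mapI) auto

text \<open>The injections vary with the object and are unrelated to each other; conjugating each
  \<open>on_mor\<close> by those of its source and target preserves functoriality.\<close>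

definition transport_functor ::
  "('o \<Rightarrow> 'w \<Rightarrow> 'v) \<Rightarrow> ('o, 'm, ('k, 'w) module, 'w \<Rightarrow> 'w) kfunctor
    \<Rightarrow> ('o, 'm, ('k, 'v) module, 'v \<Rightarrow> 'v) kfunctor" where
  "transport_functor e N =
     \<lparr>on_obj = (\<lambda>x. transport (e x) (on_obj N x)),
      on_mor = (\<lambda>x y f. \<lambda>v\<in>e x ` carrier (on_obj N x).
        e y (on_mor N x y f (inv_into (carrier (on_obj N x)) (e x) v)))\<rparr>"

lemma transport_functor_simps [simp]:
  "on_obj (transport_functor e N) x = transport (e x) (on_obj N x)"
  "\<lbrakk>inj_on (e x) (carrier (on_obj N x)); v \<in> carrier (on_obj N x)\<rbrakk>
    \<Longrightarrow> on_mor (transport_functor e N) x y f (e x v) = e y (on_mor N x y f v)"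
  by (simp_all add: transport_functor_def)

lemma linear_functor_transport:
  assumes "k_category k C" and N: "linear_functor k C (vect k) N"
    and inj: "\<And>x. x \<in> Obj C \<Longrightarrow> inj_on (e x) (carrier (on_obj N x))"
  shows "linear_functor k C (vect k) (transport_functor e N)"
proof (rule vect_functorI)
  fix x assume x: "x \<in> Obj C"
  then show "module k (on_obj (transport_functor e N) x)"
    using inj vect_functor_module[OF N] by (simp add: module_transport)
  show "on_mor (transport_functor e N) x x (Ident C x) v = v"
    if "v \<in> carrier (on_obj (transport_functor e N) x)" for v
    using that x inj vect_functor_Ident[OF N] by auto
next
  fix x y f assume xyf: "x \<in> Obj C" "y \<in> Obj C" "f \<in> carrier (Mor C x y)"
  note Nf = vect_functor_linear[OF N xyf]
  show "on_mor (transport_functor e N) x y f \<in> extensional (carrier (on_obj (transport_functor e N) x))"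
    by (simp add: transport_functor_def)
  interpret Nx: module k "on_obj N x" using vect_functor_module[OF N xyf(1)] .
  show "linear_map k (on_obj (transport_functor e N) x) (on_obj (transport_functor e N) y)
      (on_mor (transport_functor e N) x y f)"
    using xyf inj linear_map_closed[OF Nf]
    by (intro linear_mapI) (auto simp: linear_map_add[OF Nf] linear_map_smult[OF Nf])
next
  fix x y v assume xy: "x \<in> Obj C" "y \<in> Obj C" and "v \<in> carrier (on_obj (transport_functor e N) x)"
  then obtain u where u: "u \<in> carrier (on_obj N x)" and [simp]: "v = e x u" by auto
  show "linear_map k (Mor C x y) (on_obj (transport_functor e N) y) (\<lambda>f. on_mor (transport_functor e N) x y f v)"
    using linear_map_comp[OF vect_functor_linear_Mor[OF N xy u] linear_map_transport[OF inj[OF xy(2)]]] inj xy u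
    by simp
next
  fix x y z f g v
  assume *: "x \<in> Obj C" "y \<in> Obj C" "z \<in> Obj C" "f \<in> carrier (Mor C x y)" "g \<in> carrier (Mor C y z)"
    and "v \<in> carrier (on_obj (transport_functor e N) x)"
  then obtain u where u: "u \<in> carrier (on_obj N x)" and [simp]: "v = e x u" by auto
  show "on_mor (transport_functor e N) x z (Comp C x y z g f) v
      = on_mor (transport_functor e N) y z g (on_mor (transport_functor e N) x y f v)"
    using * u inj linear_map_closed[OF vect_functor_linear[OF N *(1,2,4)] u]
    by (simp add: vect_functor_Comp[OF N])
qed fact


section \<open>The induced module\<close>

context contraction
begin

text \<open>Column vectors indexed by a block, with matrices acting by multiplication. The vectors
  have type \<open>'o \<Rightarrow> 'v\<close>, so this is not yet a module over the universe
  \<open>'v\<close> and is transported afterwards.\<close>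

definition induced ::
  "('o, 'm, ('k, 'v) module, 'v \<Rightarrow> 'v) kfunctor
    \<Rightarrow> ('i, 'o \<times> 'o \<Rightarrow> 'm, ('k, 'o \<Rightarrow> 'v) module, ('o \<Rightarrow> 'v) \<Rightarrow> 'o \<Rightarrow> 'v) kfunctor" where
  "induced M =
     \<lparr>on_obj = (\<lambda>i. direct_sum (E i) (on_obj M)),
      on_mor = (\<lambda>i j m. \<lambda>v\<in>carrier (direct_sum (E i) (on_obj M)).
        \<lambda>y\<in>E j. finsum (on_obj M y) (\<lambda>x. on_mor M x y (m (y, x)) (v x)) (E i))\<rparr>"

definition inclusion :: "('o, 'm, ('k, 'v) module, 'v \<Rightarrow> 'v) kfunctor \<Rightarrow> 'o \<Rightarrow> 'v \<Rightarrow> 'o \<Rightarrow> 'v" where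
  "inclusion M x v = (\<lambda>y\<in>E (block x). if y = x then v else \<zero>\<^bsub>on_obj M y\<^esub>)"

lemma on_obj_induced [simp]: "on_obj (induced M) i = direct_sum (E i) (on_obj M)"
  by (simp add: induced_def)

lemma on_mor_induced [simp]: "v \<in> carrier (direct_sum (E i) (on_obj M)) \<Longrightarrow>
  on_mor (induced M) i j m v
    = (\<lambda>y\<in>E j. finsum (on_obj M y) (\<lambda>x. on_mor M x y (m (y, x)) (v x)) (E i))"
  by (simp add: induced_def)

lemma direct_sum_carrier:
  "i \<in> I \<Longrightarrow> carrier (direct_sum (E i) V) = (\<Pi>\<^sub>E x\<in>E i. carrier (V x))"
  by (simp add: direct_sum_finite finite_block)

context
  fixes M :: "('o, 'm, ('k, 'v) module, 'v \<Rightarrow> 'v) kfunctor"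
  assumes M: "linear_functor k D (vect k) M"
begin

lemma induced_module: "i \<in> I \<Longrightarrow> module k (direct_sum (E i) (on_obj M))"
  by (rule module_direct_sum_finite) (auto simp: is_cring finite_block intro: vect_functor_module[OF M])

text \<open>The same computation as for the matrix category, with column vectors in place of the
  rightmost factor: one surviving summand for identities, an exchange of sums for
  composites.\<close>

lemma linear_functor_induced: "linear_functor k DE (vect k) (induced M)"
proof (rule vect_functorI, unfold contracted_Obj)
  fix i assume i: "i \<in> I"
  then show "module k (on_obj (induced M) i)" by (simp add: induced_module)
  fix v assume v: "v \<in> carrier (on_obj (induced M) i)"
  then have vx: "v x \<in> carrier (on_obj M x)" if "x \<in> E i" for x
    using that i by (auto simp: direct_sum_carrier)
  have "finsum (on_obj M y) (\<lambda>x. on_mor M x y (Ident DE i (y, x)) (v x)) (E i) = v y" if y: "y \<in> E i" for y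
  proof -
    note obj [simp] = Obj_block[OF i]
    interpret My: module k "on_obj M y" using y by (simp add: vect_functor_module[OF M])
    have "finsum (on_obj M y) (\<lambda>x. on_mor M x y (Ident DE i (y, x)) (v x)) (E i)
        = on_mor M y y (Ident DE i (y, y)) (v y)"
    proof (rule My.finsum_eq_single)
      fix x assume x: "x \<in> E i" "x \<noteq> y"
      then show "on_mor M x y (Ident DE i (y, x)) (v x) = \<zero>\<^bsub>on_obj M y\<^esub>"
        using y linear_map_zero[OF Mor_module My.module_axioms vect_functor_linear_Mor[OF M]] vx
        by (simp add: contracted_Ident_entry)
    qed (use i y vx in \<open>auto simp: finite_block contracted_Ident_entry vect_functor_Ident[OF M]\<close>)
    then show ?thesis
      using y vx by (simp add: contracted_Ident_entry vect_functor_Ident[OF M])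
  qed
  then show "on_mor (induced M) i i (Ident DE i) v = v"
    using v i by (intro extensionalityI[of _ "E i" v]) (auto simp: direct_sum_carrier PiE_iff)
next
  fix i j m assume ij: "i \<in> I" "j \<in> I" and m: "m \<in> carrier (Mor DE i j)"
  show "on_mor (induced M) i j m \<in> extensional (carrier (on_obj (induced M) i))"
    by (simp add: induced_def)
  have "linear_map k (direct_sum (E i) (on_obj M)) (direct_sum (E j) (on_obj M))
      (\<lambda>v. \<lambda>y\<in>E j. finsum (on_obj M y) (\<lambda>x. on_mor M x y (m (y, x)) (v x)) (E i))"
  proof (rule linear_map_direct_sumI)
    fix y assume y: "y \<in> E j"
    have "linear_map k (direct_sum (E i) (on_obj M)) (on_obj M y) (\<lambda>v. on_mor M x y (m (y, x)) (v x))"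
      if x: "x \<in> E i" for x
      using ij x y Obj_block m
      by (intro linear_map_comp[OF linear_map_direct_sum_entry[where V = "on_obj M"] vect_functor_linear[OF M]])
        (auto simp: finite_block contracted_entry_closed)
    then show "linear_map k (direct_sum (E i) (on_obj M)) (on_obj M y)
        (\<lambda>v. (\<lambda>y\<in>E j. finsum (on_obj M y) (\<lambda>x. on_mor M x y (m (y, x)) (v x)) (E i)) y)"
      using y ij Obj_block[OF ij(2) y]
      by (simp add: linear_map_finsum_pointwise induced_module vect_functor_module[OF M])
  qed (use ij in \<open>auto simp: finite_block induced_module\<close>)
  then show "linear_map k (on_obj (induced M) i) (on_obj (induced M) j) (on_mor (induced M) i j m)"
    using ij by (simp add: induced_def linear_map_restrict induced_module)
next
  fix i j v assume ij: "i \<in> I" "j \<in> I" and v: "v \<in> carrier (on_obj (induced M) i)"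
  then have vx: "v x \<in> carrier (on_obj M x)" if "x \<in> E i" for x
    using that by (auto simp: direct_sum_carrier)
  have "linear_map k (Mor DE i j) (direct_sum (E j) (on_obj M))
      (\<lambda>m. \<lambda>y\<in>E j. finsum (on_obj M y) (\<lambda>x. on_mor M x y (m (y, x)) (v x)) (E i))"
  proof (rule linear_map_direct_sumI)
    fix y assume y: "y \<in> E j"
    have "linear_map k (Mor DE i j) (on_obj M y) (\<lambda>m. on_mor M x y (m (y, x)) (v x))"
      if x: "x \<in> E i" for x
      using ij x y Obj_block vx
      by (intro linear_map_comp[OF linear_map_contracted_entry vect_functor_linear_Mor[OF M]]) auto
    then show "linear_map k (Mor DE i j) (on_obj M y)
        (\<lambda>m. (\<lambda>y\<in>E j. finsum (on_obj M y) (\<lambda>x. on_mor M x y (m (y, x)) (v x)) (E i)) y)"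
      using y ij Obj_block[OF ij(2) y]
      by (simp add: linear_map_finsum_pointwise contracted_Mor_module vect_functor_module[OF M])
  qed (use ij in \<open>auto simp: finite_block contracted_Mor_module\<close>)
  then show "linear_map k (Mor DE i j) (on_obj (induced M) j) (\<lambda>m. on_mor (induced M) i j m v)"
    using v by simp
next
  fix i j l m n v
  assume ijl: "i \<in> I" "j \<in> I" "l \<in> I" and m: "m \<in> carrier (Mor DE i j)" and n: "n \<in> carrier (Mor DE j l)"
    and v: "v \<in> carrier (on_obj (induced M) i)"
  note [simp] = Obj_block[OF ijl(1)] Obj_block[OF ijl(2)] Obj_block[OF ijl(3)]
    contracted_entry_closed[OF m ijl(1,2)] contracted_entry_closed[OF n ijl(2,3)]
  have vx [simp]: "v x \<in> carrier (on_obj M x)" if "x \<in> E i" for x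
    using that v ijl by (auto simp: direct_sum_carrier)
  have Mm [simp]: "on_mor M x y f u \<in> carrier (on_obj M y)"
    if "x \<in> Obj D" "y \<in> Obj D" "f \<in> carrier (Mor D x y)" "u \<in> carrier (on_obj M x)" for x y f u
    using linear_map_closed[OF vect_functor_linear[OF M that(1-3)] that(4)] .
  have mod: "module k (on_obj M x)" if "x \<in> Obj D" for x using vect_functor_module[OF M that] .
  \<comment> \<open>The column vector obtained from \<open>v\<close> by the action of
    \<open>m\<close>. Its membership in the direct sum is needed before the formula for the action
    of \<open>n\<close> may be applied to it.\<close>
  define w where "w = (\<lambda>y\<in>E j. finsum (on_obj M y) (\<lambda>x. on_mor M x y (m (y, x)) (v x)) (E i))"
  have w: "w \<in> carrier (direct_sum (E j) (on_obj M))"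
    using ijl mod by (auto simp: w_def direct_sum_carrier
        intro!: abelian_monoid.finsum_closed abelian_group.axioms(1) module.axioms(2)[of k])
  have "finsum (on_obj M z) (\<lambda>x. on_mor M x z (Comp DE i j l n m (z, x)) (v x)) (E i)
      = finsum (on_obj M z) (\<lambda>y. on_mor M y z (n (z, y)) (w y)) (E j)"
    if z [simp]: "z \<in> E l" for z
  proof -
    interpret Mz: module k "on_obj M z" by (rule mod) simp
    have "finsum (on_obj M z) (\<lambda>x. on_mor M x z (Comp DE i j l n m (z, x)) (v x)) (E i)
        = finsum (on_obj M z) (\<lambda>x. finsum (on_obj M z)
            (\<lambda>y. on_mor M x z (Comp D x y z (n (z, y)) (m (y, x))) (v x)) (E j)) (E i)"
      by (intro Mz.finsum_cong')
        (auto simp: contracted_Comp_entry Comp_closed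
          intro!: linear_map_finsum[OF Mor_module Mz.module_axioms vect_functor_linear_Mor[OF M]])
    also have "\<dots> = finsum (on_obj M z) (\<lambda>y. finsum (on_obj M z)
            (\<lambda>x. on_mor M x z (Comp D x y z (n (z, y)) (m (y, x))) (v x)) (E i)) (E j)"
      using ijl by (intro Mz.finsum_swap) (auto simp: finite_block Comp_closed)
    also have "\<dots> = finsum (on_obj M z) (\<lambda>y. on_mor M y z (n (z, y)) (w y)) (E j)"
    proof (intro Mz.finsum_cong')
      fix y assume y [simp]: "y \<in> E j"
      interpret My: module k "on_obj M y" by (rule mod) simp
      have "on_mor M y z (n (z, y)) (w y)
          = finsum (on_obj M z) (\<lambda>x. on_mor M y z (n (z, y)) (on_mor M x y (m (y, x)) (v x))) (E i)"
        unfolding w_def restrict_apply'[OF y]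
        by (intro linear_map_finsum[OF My.module_axioms Mz.module_axioms vect_functor_linear[OF M]]) auto
      also have "\<dots> = finsum (on_obj M z) (\<lambda>x. on_mor M x z (Comp D x y z (n (z, y)) (m (y, x))) (v x)) (E i)"
        by (intro Mz.finsum_cong') (auto simp: vect_functor_Comp[OF M])
      finally show "finsum (on_obj M z) (\<lambda>x. on_mor M x z (Comp D x y z (n (z, y)) (m (y, x))) (v x)) (E i)
          = on_mor M y z (n (z, y)) (w y)" ..
    qed (use w ijl in \<open>auto simp: direct_sum_carrier PiE_iff\<close>)
    finally show ?thesis .
  qed
  then show "on_mor (induced M) i l (Comp DE i j l n m) v
      = on_mor (induced M) j l n (on_mor (induced M) i j m v)"
    using v w by (auto simp flip: w_def intro!: restrict_ext)
qed (rule k_category_contracted)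

section \<open>Coordinate inclusions and essential surjectivity\<close>

lemma inclusion_linear:
  assumes x: "x \<in> Obj D"
  shows "linear_map k (on_obj M x) (direct_sum (E (block x)) (on_obj M)) (inclusion M x)"
proof (rule linear_map_direct_sumI)
  fix y assume y: "y \<in> E (block x)"
  interpret module k "on_obj M y"
    using Obj_block[of "block x" y] x y by (simp add: vect_functor_module[OF M])
  show "linear_map k (on_obj M x) (on_obj M y) (\<lambda>v. inclusion M x v y)"
    using y by (intro linear_mapI) (auto simp: inclusion_def)
qed (use x in \<open>auto simp: finite_block inclusion_def vect_functor_module[OF M]\<close>)

text \<open>The matrix reads coordinate \<open>x\<close>, applies \<open>f\<close> and writes the
  result into coordinate \<open>y\<close>. In particular \<open>idem x\<close> erases all
  coordinates but \<open>x\<close>, so its fixed vectors form a copy of \<open>M x\<close>.\<close>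

lemma induced_elementary:
  assumes x: "x \<in> Obj D" and y: "y \<in> Obj D" and f: "f \<in> carrier (Mor D x y)"
    and v: "v \<in> carrier (direct_sum (E (block x)) (on_obj M))"
  shows "on_mor (induced M) (block x) (block y) (elementary y x f) v = inclusion M y (on_mor M x y f (v x))"
  unfolding on_mor_induced[OF v] inclusion_def
proof (rule restrict_ext)
  fix b assume b: "b \<in> E (block y)"
  have b': "b \<in> Obj D" using Obj_block[OF _ b] y by simp
  have va: "a \<in> Obj D" "v a \<in> carrier (on_obj M a)" if "a \<in> E (block x)" for a
    using that v x Obj_block[OF _ that] by (auto simp: direct_sum_carrier)
  interpret Mb: module k "on_obj M b" using b' by (rule vect_functor_module[OF M])
  have zero: "on_mor M a b \<zero>\<^bsub>Mor D a b\<^esub> (v a) = \<zero>\<^bsub>on_obj M b\<^esub>" if "a \<in> E (block x)" for a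
    using va[OF that] b' linear_map_zero[OF Mor_module Mb.module_axioms vect_functor_linear_Mor[OF M]] by simp
  have fvx: "on_mor M x y f (v x) \<in> carrier (on_obj M y)"
    using linear_map_closed[OF vect_functor_linear[OF M x y f]] va x by simp
  have "finsum (on_obj M b) (\<lambda>a. on_mor M a b (elementary y x f (b, a)) (v a)) (E (block x))
      = on_mor M x b (elementary y x f (b, x)) (v x)"
    using b x zero fvx
    by (intro Mb.finsum_eq_single) (auto simp: finite_block elementary_entry)
  then show "finsum (on_obj M b) (\<lambda>a. on_mor M a b (elementary y x f (b, a)) (v a)) (E (block x))
      = (if b = y then on_mor M x y f (v x) else \<zero>\<^bsub>on_obj M b\<^esub>)"
    using b x zero by (simp add: elementary_entry)
qed

end

text \<open>The witness \<open>N\<close> is the induced module transported into \<open>'v\<close>.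
  The coordinate inclusion at \<open>x\<close>, followed by the encoding of the block, identifies
  \<open>M x\<close> with the corner of \<open>N\<close> at \<open>x\<close>; the resulting
  isomorphism is inverted at the end.\<close>

lemma corner_functor_essentially_surjective:
  fixes M :: "('o, 'm, ('k, 'v::infinite) module, 'v \<Rightarrow> 'v) kfunctor"
  assumes M: "linear_functor k D (vect k) M"
  shows "\<exists>N. linear_functor k DE (vect k) N
    \<and> (\<exists>\<eta>. is_iso (functor_category k D (vect k)) (corner N) M \<eta>)"
proof -
  have "\<exists>e :: ('o \<Rightarrow> 'v) \<Rightarrow> 'v. inj_on e (carrier (direct_sum (E i) (on_obj M)))" if i: "i \<in> I" for i
  proof -
    obtain e :: "('o \<Rightarrow> 'v) \<Rightarrow> 'v" where "inj_on e (extensional (E i))"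
      using exists_inj_on_extensional_infinite[OF finite_block[OF i]] by blast
    then have "inj_on e (carrier (direct_sum (E i) (on_obj M)))"
      by (rule inj_on_subset) (auto simp: direct_sum_carrier[OF i] PiE_def)
    then show ?thesis by blast
  qed
  then obtain e :: "'i \<Rightarrow> ('o \<Rightarrow> 'v) \<Rightarrow> 'v"
    where e: "\<And>i. i \<in> I \<Longrightarrow> inj_on (e i) (carrier (direct_sum (E i) (on_obj M)))"
    by metis
  define N where "N = transport_functor e (induced M)"
  have N: "linear_functor k DE (vect k) N"
    unfolding N_def using e
    by (intro linear_functor_transport k_category_contracted linear_functor_induced M) auto
  define \<iota> where "\<iota> x v = e (block x) (inclusion M x v)" for x v
  have incl: "inclusion M x v \<in> carrier (direct_sum (E (block x)) (on_obj M))"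
    if "x \<in> Obj D" "v \<in> carrier (on_obj M x)" for x v
    using linear_map_closed[OF inclusion_linear[OF M that(1)] that(2)] .
  have incl_same [simp]: "inclusion M x v x = v" if "x \<in> Obj D" for x v
    using that by (simp add: inclusion_def)
  have on_mor_N: "on_mor N (block x) (block y) (elementary y x f) (e (block x) w)
      = \<iota> y (on_mor M x y f (w x))"
    if "x \<in> Obj D" "y \<in> Obj D" "f \<in> carrier (Mor D x y)"
      "w \<in> carrier (direct_sum (E (block x)) (on_obj M))" for x y f w
    using that e by (simp add: N_def \<iota>_def induced_elementary[OF M] del: on_mor_induced)
  have wx: "w x \<in> carrier (on_obj M x)"
    if "x \<in> Obj D" "w \<in> carrier (direct_sum (E (block x)) (on_obj M))" for x w
    using that by (auto simp: direct_sum_carrier)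
  \<comment> \<open>In encoded form, the projection at \<open>x\<close> keeps coordinate
    \<open>x\<close> and clears the others.\<close>
  have proj_N: "proj N x (e (block x) w) = \<iota> x (w x)"
    if "x \<in> Obj D" "w \<in> carrier (direct_sum (E (block x)) (on_obj M))" for x w
    using that on_mor_N[of x x "Ident D x" w] wx
    by (simp add: proj_def Ident_closed vect_functor_Ident[OF M])
  have on_obj_N: "on_obj N i = transport (e i) (direct_sum (E i) (on_obj M))" for i
    by (simp add: N_def)
  have \<iota>_closed: "\<iota> x v \<in> carrier (corner_space N x)" if "x \<in> Obj D" "v \<in> carrier (on_obj M x)" for x v
    using that incl proj_N[OF that(1) incl[OF that]] by (simp add: on_obj_N \<iota>_def)
  have \<iota>_lin: "linear_map k (on_obj M x) (corner_space N x) (\<iota> x)" if x: "x \<in> Obj D" for x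
  proof -
    have "linear_map k (on_obj M x) (on_obj N (block x)) (\<iota> x)"
      unfolding \<iota>_def on_obj_N using x e
      by (intro linear_map_comp[OF inclusion_linear[OF M] linear_map_transport]) auto
    then show ?thesis
      using \<iota>_closed[OF x] by (auto simp: linear_map_def Pi_iff)
  qed
  have \<iota>_bij: "bij_betw (\<iota> x) (carrier (on_obj M x)) (carrier (corner_space N x))" if x: "x \<in> Obj D" for x
  proof (rule bij_betw_imageI)
    show "inj_on (\<iota> x) (carrier (on_obj M x))"
    proof (rule inj_onI)
      fix u v assume uv: "u \<in> carrier (on_obj M x)" "v \<in> carrier (on_obj M x)" and "\<iota> x u = \<iota> x v"
      then have "inclusion M x u = inclusion M x v"
        using e[of "block x"] x incl[OF x] by (auto simp: \<iota>_def inj_on_def)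
      then have "inclusion M x u x = inclusion M x v x" by simp
      then show "u = v" using x by simp
    qed
    show "\<iota> x ` carrier (on_obj M x) = carrier (corner_space N x)"
    proof (intro equalityI subsetI)
      fix u assume "u \<in> carrier (corner_space N x)"
      then obtain w where "w \<in> carrier (direct_sum (E (block x)) (on_obj M))" "u = e (block x) w"
        "proj N x u = u"
        by (auto simp: on_obj_N)
      \<comment> \<open>A fixed vector \<open>e (block x) w\<close> equals its projection
        \<open>\<iota> x (w x)\<close>, so its coordinate at \<open>x\<close> is the
        preimage.\<close>
      then show "u \<in> \<iota> x ` carrier (on_obj M x)"
        using proj_N[OF x] wx[OF x] by (auto intro!: image_eqI[of _ _ "w x"])
    qed (use \<iota>_closed[OF x] in blast)
  qed
  have "(\<lambda>x\<in>Obj D. \<lambda>v\<in>carrier (on_obj M x). \<iota> x v) \<in> nat_trans D (vect k) M (corner N)"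
  proof (rule restrict_vect_nat_transI[OF M])
    fix x y f v assume *: "x \<in> Obj D" "y \<in> Obj D" "f \<in> carrier (Mor D x y)" "v \<in> carrier (on_obj M x)"
    then show "\<iota> y (on_mor M x y f v) = on_mor (corner N) x y f (\<iota> x v)"
      using on_mor_N[OF *(1-3) incl[OF *(1,4)]] \<iota>_closed[OF *(1,4)] by (simp add: \<iota>_def)
  qed (simp add: \<iota>_lin)
  moreover have "is_iso (vect k) (on_obj M x) (on_obj (corner N) x) ((\<lambda>x\<in>Obj D. \<lambda>v\<in>carrier (on_obj M x). \<iota> x v) x)"
    if x: "x \<in> Obj D" for x
  proof (rule is_iso_vectI)
    show "module k (on_obj M x)" by (rule vect_functor_module[OF M x])
    then show "linear_map k (on_obj M x) (on_obj (corner N) x) ((\<lambda>x\<in>Obj D. \<lambda>v\<in>carrier (on_obj M x). \<iota> x v) x)"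
      using x by (simp add: linear_map_restrict \<iota>_lin)
    show "bij_betw ((\<lambda>x\<in>Obj D. \<lambda>v\<in>carrier (on_obj M x). \<iota> x v) x) (carrier (on_obj M x))
        (carrier (on_obj (corner N) x))"
      using \<iota>_bij[OF x] x
      by (subst bij_betw_cong[where g = "\<iota> x"]) (simp_all del: corner_space_simps)
  qed (use x in \<open>simp_all add: corner_space_module[OF N]\<close>)
  ultimately have "is_iso (functor_category k D (vect k)) M (corner N)
      (\<lambda>x\<in>Obj D. \<lambda>v\<in>carrier (on_obj M x). \<iota> x v)"
    by (intro is_iso_functor_categoryI k_category_vect field_axioms M linear_functor_corner[OF N])
  from is_iso_sym[OF this] N show ?thesis by blast
qed

end

theorem proposition2p8:
  fixes k :: "('k, 'r) ring_scheme"
    and D :: "('k, 'o, 'm) kcat"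
    and I :: "'i set"
    and E :: "'i \<Rightarrow> 'o set"
  assumes "field k"
    and "k_category k D"
    and "indexed_partition (Obj D) I E"
    and "\<And>i. i \<in> I \<Longrightarrow> finite (E i)"
  shows "morita_equivalent TYPE('v::infinite) k D (contracted_category D I E)"
proof -
  interpret contraction k D I E
    using assms by (intro contraction.intro contraction_axioms.intro)
  let ?V = "vect k :: ('k, ('k, 'v) module, 'v \<Rightarrow> 'v) kcat"
  have "k_equivalent k (functor_category k D ?V) (functor_category k DE ?V)"
  \<comment> \<open>The criterion names the target of its functor first. Corners lead from modules
    over \<open>DE\<close> to modules over \<open>D\<close>, so it yields the equivalence in the
    order demanded by \<open>morita_equivalent\<close>.\<close>
  proof (rule k_equivalent_if_fully_faithful_essentially_surjective[OF _ _ linear_functor_corner_functor])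
    fix N N' :: "('i, 'o \<times> 'o \<Rightarrow> 'm, ('k, 'v) module, 'v \<Rightarrow> 'v) kfunctor"
    assume "N \<in> Obj (functor_category k DE (vect k))" "N' \<in> Obj (functor_category k DE (vect k))"
    then have N: "linear_functor k DE (vect k) N" and N': "linear_functor k DE (vect k) N'" by auto
    show "bij_betw (on_mor corner_functor N N') (carrier (Mor (functor_category k DE (vect k)) N N'))
        (carrier (Mor (functor_category k D (vect k)) (on_obj corner_functor N) (on_obj corner_functor N')))"
      unfolding functor_category_simps corner_functor_simps(1)
    proof (rule bij_betw_imageI)
      show "inj_on (on_mor corner_functor N N') (nat_trans DE (vect k) N N')"
        by (intro inj_onI corner_functor_faithful[OF N N'])
      show "on_mor corner_functor N N' ` nat_trans DE (vect k) N N' = nat_trans D (vect k) (corner N) (corner N')"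
      proof (intro equalityI subsetI)
        fix \<theta> assume "\<theta> \<in> nat_trans D (vect k) (corner N) (corner N')"
        then obtain \<phi> where "\<phi> \<in> nat_trans DE (vect k) N N'" "on_mor corner_functor N N' \<phi> = \<theta>"
          by (rule corner_functor_full[OF N N'])
        then show "\<theta> \<in> on_mor corner_functor N N' ` nat_trans DE (vect k) N N'"
          by (metis imageI)
      qed (use nat_trans_corner[OF N N'] in blast)
    qed
  next
    fix M :: "('o, 'm, ('k, 'v) module, 'v \<Rightarrow> 'v) kfunctor"
    assume "M \<in> Obj (functor_category k D (vect k))"
    then show "\<exists>N\<in>Obj (functor_category k DE (vect k)).
        \<exists>\<eta>. is_iso (functor_category k D (vect k)) (on_obj corner_functor N) M \<eta>"
      using corner_functor_essentially_surjective[of M] by auto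
  qed (intro k_category_functor_category k_category_vect assms)+
  then show ?thesis
    using assms(2) k_category_contracted by (simp add: morita_equivalent_def left_modules_def)
qed

end
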